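(* Let $\mathbf{d}$ be a nonzero Turing degree. If $\mathbf{d}$ is low for isomorphism, then $\mathbf{d}$ is low for isometric isomorphism of Banach spaces.
   Context: **Low for isomorphism (countable algebraic structures).** A Turing degree $\mathbf{d}$ is low for isomorphism if, whenever $\mathcal{A}$ and $\mathcal{B}$ are computably presented countable algebraic structures (domain a computable subset of $\mathbb{N}$, computable language, operations, relations and constants uniformly computable) in the same language and there is a $\mathbf{d}$-computable isomorphism from $\mathcal{A}$ onto $\mathcal{B}$, there is a computable isomorphism from $\mathcal{A}$ onto $\mathcal{B}$. **Banach spaces and presentations.** The scalar field $\mathbb{F}$ is $\mathbb{R}$ or $\mathbb{C}$, and rational scalars are the elements of $\mathbb{F}\cap\mathbb{Q}(i)$. Banach spaces over $\mathbb{F}$ are regarded as metric structures (metric $d(u,v)=\|u-v\|$) with vector addition and multiplication by each rational scalar as operations, the norm as a functional and the zero vector as a constant; an isometric isomorphism is a linear isometric bijection. A presentation of a Banach space $\mathcal{B}$ is a pair $\mathcal{B}^\#=(\mathcal{B},(v_n)_{n\in\mathbb{N}})$ where the closed linear span of $(v_n)_{n\in\mathbb{N}}$ is $\mathcal{B}$; the $v_n$ are the distinguished points. The rational points of $\mathcal{B}^\#$ are the finite linear combinations of distinguished points with rational scalar coefficients; a rational ball is an open ball centered at a rational point with positive rational radius. These are effectively numbered. $\mathcal{B}^\#$ is computable if there is an algorithm that, given a rational point $v$ of $\mathcal{B}^\#$ and $k\in\mathbb{N}$, computes a rational $q$ with $|q-\|v\||<2^{-k}$. **Computable maps.** A map $\Phi:\mathcal{B}_0\to\mathcal{B}_1$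 is a computable map of $\mathcal{B}_0^\#$ into $\mathcal{B}_1^\#$ if there is an algorithm $P$ such that: given a rational ball $B_0$ of $\mathcal{B}_0^\#$, $P$ either does not halt or produces a rational ball $B_1$ of $\mathcal{B}_1^\#$ with $\Phi[B_0]\subseteq B_1$; and whenever $U$ is a neighborhood of $\Phi(p)$ there is a rational ball $B_0\ni p$ on which $P$ halts with $P(B_0)\subseteq U$. This relativizes to give $\mathbf{d}$-computable maps. **Low for isometric isomorphism of Banach spaces.** A nonzero Turing degree $\mathbf{d}$ is low for isometric isomorphism of Banach spaces if for every Banach space $\mathcal{B}$ and all computable presentations $\mathcal{B}^\#,\mathcal{B}^+$ of $\mathcal{B}$: if there is a $\mathbf{d}$-computable isometric isomorphism of $\mathcal{B}^+$ onto $\mathcal{B}^\#$, then there is a computable isometric isomorphism of $\mathcal{B}^+$ onto $\mathcal{B}^\#$. *)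

theory Defs
  imports "HOL-Analysis.Analysis" "HOL-Library.Nat_Bijection"
begin

section \<open>Oracle computability and Turing degrees\<close>

definition minimization :: "(nat \<rightharpoonup> nat) \<Rightarrow> nat option" where
  "minimization g =
     (if \<exists>k. g k = Some 0 \<and> (\<forall>j<k. \<exists>y. g j = Some (Suc y))
      then Some (LEAST k. g k = Some 0) else None)"

text \<open>Kleene's partial recursive functions relative to the oracle set \<open>A\<close>, in unary form:
  several arguments are packed with the Cantor pairing \<^const>\<open>prod_encode\<close>, so that its two
  projections and pairing replace the projection and tupling schemes.  The identity is the pairing
  of the two projections.\<close>

inductive partial_recursive_in :: "nat set \<Rightarrow> (nat \<rightharpoonup> nat) \<Rightarrow> bool" for A :: "nat set" where
  pr_zero: "partial_recursive_in A (\<lambda>n. Some 0)"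
| pr_succ: "partial_recursive_in A (\<lambda>n. Some (Suc n))"
| pr_fst: "partial_recursive_in A (\<lambda>n. Some (fst (prod_decode n)))"
| pr_snd: "partial_recursive_in A (\<lambda>n. Some (snd (prod_decode n)))"
| pr_oracle: "partial_recursive_in A (\<lambda>n. Some (of_bool (n \<in> A)))"
| pr_pair: "partial_recursive_in A f \<Longrightarrow> partial_recursive_in A g \<Longrightarrow>
    partial_recursive_in A
      (\<lambda>n. Option.bind (f n) (\<lambda>x. Option.bind (g n) (\<lambda>y. Some (prod_encode (x, y)))))"
| pr_comp: "partial_recursive_in A f \<Longrightarrow> partial_recursive_in A g \<Longrightarrow>
    partial_recursive_in A (\<lambda>n. Option.bind (g n) f)"
| pr_primrec: "partial_recursive_in A f \<Longrightarrow> partial_recursive_in A g \<Longrightarrow>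
    partial_recursive_in A
      (\<lambda>n. rec_nat (f (fst (prod_decode n)))
         (\<lambda>k r. Option.bind r (\<lambda>y. g (prod_encode (fst (prod_decode n), prod_encode (k, y)))))
         (snd (prod_decode n)))"
| pr_min: "partial_recursive_in A f \<Longrightarrow>
    partial_recursive_in A (\<lambda>n. minimization (\<lambda>k. f (prod_encode (n, k))))"

text \<open>The empty oracle only contributes the constant function zero.\<close>

abbreviation partial_recursive :: "(nat \<rightharpoonup> nat) \<Rightarrow> bool" where
  "partial_recursive \<equiv> partial_recursive_in {}"

definition decidable :: "nat set \<Rightarrow> bool" where
  "decidable S \<longleftrightarrow> partial_recursive (\<lambda>n. Some (of_bool (n \<in> S)))"

definition turing_reducible :: "nat set \<Rightarrow> nat set \<Rightarrow> bool" where
  "turing_reducible S A \<longleftrightarrow> partial_recursive_in A (\<lambda>n. Some (of_bool (n \<in> S)))"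

definition turing_equivalence :: "(nat set \<times> nat set) set" where
  "turing_equivalence = {(A, B). turing_reducible A B \<and> turing_reducible B A}"

definition turing_degrees :: "nat set set set" where
  "turing_degrees = UNIV // turing_equivalence"

definition zero_degree :: "nat set set" where
  "zero_degree = turing_equivalence `` {{}}"

lemma partial_recursive_in_trans:
  assumes "partial_recursive_in A f" "turing_reducible A B"
  shows "partial_recursive_in B f"
  using assms(1)
  by induction (use assms(2) in \<open>auto intro: partial_recursive_in.intros
    simp: turing_reducible_def\<close>)

lemma equiv_turing_equivalence: "equiv UNIV turing_equivalence"
proof (rule equivI)
  show "turing_equivalence \<subseteq> UNIV \<times> UNIV" by simp
  show "refl turing_equivalence"
    by (auto simp: refl_on_def turing_equivalence_def turing_reducible_def intro: pr_oracle)
  show "sym turing_equivalence"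
    by (auto simp: sym_def turing_equivalence_def)
  show "trans turing_equivalence"
    unfolding trans_def turing_equivalence_def
    by (auto simp: turing_reducible_def intro: partial_recursive_in_trans)
qed

section \<open>Computable structures and lowness for isomorphism\<close>

record language =
  rel_symbols :: "nat set"
  rel_arity :: "nat \<Rightarrow> nat"
  fun_symbols :: "nat set"
  fun_arity :: "nat \<Rightarrow> nat"
  const_symbols :: "nat set"

record countable_structure =
  universe :: "nat set"
  rel_interp :: "nat \<Rightarrow> nat list \<Rightarrow> bool"
  fun_interp :: "nat \<Rightarrow> nat list \<Rightarrow> nat"
  const_interp :: "nat \<Rightarrow> nat"

definition computable_language :: "language \<Rightarrow> bool" where
  "computable_language L \<longleftrightarrow>
     decidable (rel_symbols L) \<and> decidable (fun_symbols L) \<and> decidable (const_symbols L) \<and>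
     (\<exists>g. partial_recursive g \<and> (\<forall>r\<in>rel_symbols L. g r = Some (rel_arity L r))) \<and>
     (\<exists>g. partial_recursive g \<and> (\<forall>f\<in>fun_symbols L. g f = Some (fun_arity L f)))"

definition tuples :: "nat set \<Rightarrow> nat \<Rightarrow> nat list set" where
  "tuples D k = {xs. length xs = k \<and> set xs \<subseteq> D}"

definition structure_for :: "language \<Rightarrow> countable_structure \<Rightarrow> bool" where
  "structure_for L M \<longleftrightarrow>
     (\<forall>f\<in>fun_symbols L. \<forall>xs\<in>tuples (universe M) (fun_arity L f). fun_interp M f xs \<in> universe M) \<and>
     (\<forall>c\<in>const_symbols L. const_interp M c \<in> universe M)"

definition computable_structure :: "language \<Rightarrow> countable_structure \<Rightarrow> bool" where
  "computable_structure L M \<longleftrightarrow>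
     structure_for L M \<and> decidable (universe M) \<and>
     (\<exists>g. partial_recursive g \<and>
        (\<forall>r\<in>rel_symbols L. \<forall>xs\<in>tuples (universe M) (rel_arity L r).
           g (prod_encode (r, list_encode xs)) = Some (of_bool (rel_interp M r xs)))) \<and>
     (\<exists>g. partial_recursive g \<and>
        (\<forall>f\<in>fun_symbols L. \<forall>xs\<in>tuples (universe M) (fun_arity L f).
           g (prod_encode (f, list_encode xs)) = Some (fun_interp M f xs))) \<and>
     (\<exists>g. partial_recursive g \<and> (\<forall>c\<in>const_symbols L. g c = Some (const_interp M c)))"

definition structure_isomorphism ::
  "language \<Rightarrow> countable_structure \<Rightarrow> countable_structure \<Rightarrow> (nat \<Rightarrow> nat) \<Rightarrow> bool" where
  "structure_isomorphism L M N h \<longleftrightarrow>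
     bij_betw h (universe M) (universe N) \<and>
     (\<forall>r\<in>rel_symbols L. \<forall>xs\<in>tuples (universe M) (rel_arity L r).
        rel_interp N r (map h xs) \<longleftrightarrow> rel_interp M r xs) \<and>
     (\<forall>f\<in>fun_symbols L. \<forall>xs\<in>tuples (universe M) (fun_arity L f).
        fun_interp N f (map h xs) = h (fun_interp M f xs)) \<and>
     (\<forall>c\<in>const_symbols L. const_interp N c = h (const_interp M c))"

definition computably_isomorphic_in ::
  "nat set \<Rightarrow> language \<Rightarrow> countable_structure \<Rightarrow> countable_structure \<Rightarrow> bool" where
  "computably_isomorphic_in A L M N \<longleftrightarrow>
     (\<exists>h g. structure_isomorphism L M N h \<and> partial_recursive_in A g \<and>
        (\<forall>x\<in>universe M. g x = Some (h x)))"

definition low_for_isomorphism :: "nat set set \<Rightarrow> bool" where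
  "low_for_isomorphism d \<longleftrightarrow>
     (\<forall>L M N. computable_language L \<and> computable_structure L M \<and> computable_structure L N \<and>
        (\<exists>A\<in>d. computably_isomorphic_in A L M N) \<longrightarrow> computably_isomorphic_in {} L M N)"

section \<open>Banach spaces and their presentations\<close>

text \<open>The scalar field \<open>F\<close> is a subset of the complex numbers, either the reals or everything.
  A Banach space over \<open>F\<close> is a real Banach space (class \<^class>\<open>banach\<close>) together with a scalar
  multiplication \<open>s\<close> by elements of \<open>F\<close> that extends the real one and for which the norm is
  homogeneous.  For \<open>F = \<real>\<close>, the values of \<open>s\<close> at nonreal numbers are irrelevant.\<close>

definition banach_space_over :: "complex set \<Rightarrow> (complex \<Rightarrow> 'a::banach \<Rightarrow> 'a) \<Rightarrow> bool" where
  "banach_space_over F s \<longleftrightarrow>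
     (\<forall>r x. s (complex_of_real r) x = r *\<^sub>R x) \<and>
     (F = \<real> \<or> F = UNIV \<and> vector_space s \<and> (\<forall>c x. norm (s c x) = cmod c * norm x))"

definition rational_scalars :: "complex set \<Rightarrow> complex set" where
  "rational_scalars F = F \<inter> {Complex a b | a b. a \<in> \<rat> \<and> b \<in> \<rat>}"

definition linear_combinations ::
  "complex set \<Rightarrow> (complex \<Rightarrow> 'a::banach \<Rightarrow> 'a) \<Rightarrow> (nat \<Rightarrow> 'a) \<Rightarrow> 'a set" where
  "linear_combinations K s v = {\<Sum>i<n. s (c i) (v i) | n c. \<forall>i<n. c i \<in> K}"

definition is_presentation ::
  "complex set \<Rightarrow> (complex \<Rightarrow> 'a::banach \<Rightarrow> 'a) \<Rightarrow> (nat \<Rightarrow> 'a) \<Rightarrow> bool" where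
  "is_presentation F s v \<longleftrightarrow> closure (linear_combinations F s v) = UNIV"

definition rational_of_code :: "nat \<Rightarrow> real" where
  "rational_of_code n =
     (case prod_decode n of (a, b) \<Rightarrow> of_int (int_decode a) / of_nat (Suc b))"

definition positive_rational_of_code :: "nat \<Rightarrow> real" where
  "positive_rational_of_code n = (case prod_decode n of (a, b) \<Rightarrow> of_nat (Suc a) / of_nat (Suc b))"

definition scalar_of_code :: "complex set \<Rightarrow> nat \<Rightarrow> complex" where
  "scalar_of_code F n =
     (if F = \<real> then complex_of_real (rational_of_code n)
      else case prod_decode n of (a, b) \<Rightarrow> Complex (rational_of_code a) (rational_of_code b))"

definition rational_point ::
  "complex set \<Rightarrow> (complex \<Rightarrow> 'a::banach \<Rightarrow> 'a) \<Rightarrow> (nat \<Rightarrow> 'a) \<Rightarrow> nat \<Rightarrow> 'a" where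
  "rational_point F s v n =
     (\<Sum>i<length (list_decode n). s (scalar_of_code F (list_decode n ! i)) (v i))"

definition rational_ball ::
  "complex set \<Rightarrow> (complex \<Rightarrow> 'a::banach \<Rightarrow> 'a) \<Rightarrow> (nat \<Rightarrow> 'a) \<Rightarrow> nat \<Rightarrow> 'a set" where
  "rational_ball F s v n =
     (case prod_decode n of (p, r) \<Rightarrow> ball (rational_point F s v p) (positive_rational_of_code r))"

text \<open>The numberings enumerate exactly the intended objects.\<close>

lemma range_rational_of_code: "range rational_of_code = \<rat>"
proof
  show "range rational_of_code \<subseteq> \<rat>"
    by (auto simp: rational_of_code_def split: prod.split)
  show "\<rat> \<subseteq> range rational_of_code"
  proof
    fix x :: real assume "x \<in> \<rat>"
    then obtain a b where ab: "b > 0" "x = of_int a / of_int b"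
      by (metis Rats_cases')
    have "x = rational_of_code (prod_encode (int_encode a, nat b - 1))"
      using ab by (simp add: rational_of_code_def)
    then show "x \<in> range rational_of_code" by blast
  qed
qed

lemma range_positive_rational_of_code:
  "range positive_rational_of_code = {q. q \<in> \<rat> \<and> q > 0}"
proof
  show "range positive_rational_of_code \<subseteq> {q. q \<in> \<rat> \<and> q > 0}"
    by (auto simp: positive_rational_of_code_def split: prod.split)
  show "{q. q \<in> \<rat> \<and> q > 0} \<subseteq> range positive_rational_of_code"
  proof clarify
    fix x :: real assume "x \<in> \<rat>" "x > 0"
    then obtain a b where ab: "b > 0" "x = of_int a / of_int b"
      by (metis Rats_cases')
    with \<open>x > 0\<close> have "a > 0" by (simp add: zero_less_divide_iff)
    have "x = positive_rational_of_code (prod_encode (nat a - 1, nat b - 1))"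
      using ab \<open>a > 0\<close> by (simp add: positive_rational_of_code_def)
    then show "x \<in> range positive_rational_of_code" by blast
  qed
qed

lemma range_scalar_of_code:
  assumes "F = \<real> \<or> F = UNIV"
  shows "range (scalar_of_code F) = rational_scalars F"
proof (cases "F = \<real>")
  case True
  have "scalar_of_code F = (\<lambda>n. complex_of_real (rational_of_code n))"
    by (rule ext) (simp add: scalar_of_code_def True)
  then have "range (scalar_of_code F) = complex_of_real ` \<rat>"
    by (simp add: image_image flip: range_rational_of_code)
  also have "\<dots> = rational_scalars F"
    by (auto simp: rational_scalars_def True complex_is_Real_iff complex_of_real_def)
  finally show ?thesis .
next
  case False
  with assms have F: "F = UNIV" by auto
  have "Complex a b \<in> range (scalar_of_code F)" if "a \<in> \<rat>" "b \<in> \<rat>" for a b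
  proof -
    from that obtain m n where "a = rational_of_code m" "b = rational_of_code n"
      by (metis imageE range_rational_of_code)
    then have "Complex a b = scalar_of_code F (prod_encode (m, n))"
      using False by (simp add: scalar_of_code_def)
    then show ?thesis by blast
  qed
  moreover have "rational_of_code n \<in> \<rat>" for n
    using range_rational_of_code by blast
  ultimately show ?thesis
    using False F by (auto simp: rational_scalars_def scalar_of_code_def split: prod.split)
qed

lemma range_rational_point:
  assumes "F = \<real> \<or> F = UNIV"
  shows "range (rational_point F s v) = linear_combinations (rational_scalars F) s v"
proof
  show "range (rational_point F s v) \<subseteq> linear_combinations (rational_scalars F) s v"
  proof
    fix x assume "x \<in> range (rational_point F s v)"
    then obtain n where x: "x = rational_point F s v n" by blast
    have "\<forall>i<length (list_decode n). scalar_of_code F (list_decode n ! i) \<in> rational_scalars F"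
      using range_scalar_of_code[OF assms] by blast
    with x show "x \<in> linear_combinations (rational_scalars F) s v"
      unfolding linear_combinations_def rational_point_def mem_Collect_eq
      by (intro exI[of _ "length (list_decode n)"]
          exI[of _ "\<lambda>i. scalar_of_code F (list_decode n ! i)"]) simp
  qed
  show "linear_combinations (rational_scalars F) s v \<subseteq> range (rational_point F s v)"
  proof
    fix x assume "x \<in> linear_combinations (rational_scalars F) s v"
    then obtain n c where c: "\<forall>i<n. c i \<in> rational_scalars F" "x = (\<Sum>i<n. s (c i) (v i))"
      unfolding linear_combinations_def by blast
    then have "\<forall>i<n. \<exists>m. c i = scalar_of_code F m"
      using range_scalar_of_code[OF assms] by blast
    then obtain m where "\<forall>i<n. c i = scalar_of_code F (m i)" by metis
    with c have "x = rational_point F s v (list_encode (map m [0..<n]))"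
      by (simp add: rational_point_def)
    then show "x \<in> range (rational_point F s v)" by blast
  qed
qed

definition computable_presentation ::
  "complex set \<Rightarrow> (complex \<Rightarrow> 'a::banach \<Rightarrow> 'a) \<Rightarrow> (nat \<Rightarrow> 'a) \<Rightarrow> bool" where
  "computable_presentation F s v \<longleftrightarrow>
     is_presentation F s v \<and>
     (\<exists>f. partial_recursive f \<and>
        (\<forall>n k. \<exists>q. f (prod_encode (n, k)) = Some q \<and>
           \<bar>rational_of_code q - norm (rational_point F s v n)\<bar> < (1/2) ^ k))"

text \<open>A map from the space \<open>s0\<close> presented by \<open>v0\<close> into the space \<open>s1\<close> presented by \<open>v1\<close>,
  computable relative to \<open>A\<close>; the algorithm \<open>P\<close> acts on codes of rational balls.\<close>

definition computable_map_in ::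
  "nat set \<Rightarrow> complex set \<Rightarrow> (complex \<Rightarrow> 'a::banach \<Rightarrow> 'a) \<Rightarrow> (nat \<Rightarrow> 'a) \<Rightarrow>
     (complex \<Rightarrow> 'b::banach \<Rightarrow> 'b) \<Rightarrow> (nat \<Rightarrow> 'b) \<Rightarrow> ('a \<Rightarrow> 'b) \<Rightarrow> bool" where
  "computable_map_in A F s0 v0 s1 v1 \<Phi> \<longleftrightarrow>
     (\<exists>P. partial_recursive_in A P \<and>
        (\<forall>m n. P m = Some n \<longrightarrow> \<Phi> ` rational_ball F s0 v0 m \<subseteq> rational_ball F s1 v1 n) \<and>
        (\<forall>p U. \<Phi> p \<in> interior U \<longrightarrow>
           (\<exists>m n. p \<in> rational_ball F s0 v0 m \<and> P m = Some n \<and> rational_ball F s1 v1 n \<subseteq> U)))"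

definition isometric_isomorphism ::
  "complex set \<Rightarrow> (complex \<Rightarrow> 'a::banach \<Rightarrow> 'a) \<Rightarrow> (complex \<Rightarrow> 'b::banach \<Rightarrow> 'b) \<Rightarrow>
     ('a \<Rightarrow> 'b) \<Rightarrow> bool" where
  "isometric_isomorphism F s0 s1 \<Phi> \<longleftrightarrow>
     bij \<Phi> \<and> (\<forall>x y. \<Phi> (x + y) = \<Phi> x + \<Phi> y) \<and> (\<forall>c\<in>F. \<forall>x. \<Phi> (s0 c x) = s1 c (\<Phi> x)) \<and>
     (\<forall>x y. dist (\<Phi> x) (\<Phi> y) = dist x y)"

definition isometrically_isomorphic_in ::
  "nat set \<Rightarrow> complex set \<Rightarrow> (complex \<Rightarrow> 'a::banach \<Rightarrow> 'a) \<Rightarrow> (nat \<Rightarrow> 'a) \<Rightarrow>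
     (complex \<Rightarrow> 'b::banach \<Rightarrow> 'b) \<Rightarrow> (nat \<Rightarrow> 'b) \<Rightarrow> bool" where
  "isometrically_isomorphic_in A F s0 v0 s1 v1 \<longleftrightarrow>
     (\<exists>\<Phi>. isometric_isomorphism F s0 s1 \<Phi> \<and> computable_map_in A F s0 v0 s1 v1 \<Phi>)"

text \<open>A definition cannot quantify over types, so the carrier type of the Banach spaces is an
  argument.  The degree is low for isometric isomorphism of Banach spaces if this holds for all
  types of class \<^class>\<open>banach\<close>.\<close>

definition low_for_isometric_isomorphism :: "'a::banach itself \<Rightarrow> nat set set \<Rightarrow> bool" where
  "low_for_isometric_isomorphism T d \<longleftrightarrow>
     (\<forall>F (s :: complex \<Rightarrow> 'a \<Rightarrow> 'a) v w.
        banach_space_over F s \<and> computable_presentation F s v \<and> computable_presentation F s w \<and>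
        (\<exists>A\<in>d. isometrically_isomorphic_in A F s w s v) \<longrightarrow>
        isometrically_isomorphic_in {} F s w s v)"

end

theory Submission
  imports Defs
begin

text \<open>A degree that is low for isomorphism is low for paths: if a closed subset of Baire space given
  by a decidable set of admissible finite histories has a member computable in the degree, then it
  has a computable member.  To see this, consider at each level the finite sets of nodes as vectors
  over the two-element field, with the linear maps induced by taking parents.  The sets of even size
  and those of odd size form two computable structures; translation by the nodes of a path is an
  isomorphism between them, and from any isomorphism, which maps the empty sets to compatible sets
  of odd size, a path can be computed.

  An isometric isomorphism of Banach spaces is determined by approximate values at rational points,
  and the data of approximate values together with approximate preimages, which witness
  surjectivity, are characterized by inequalities between norms that may be tested up to a
  fixed multiple of the precision.  So these data are the members of such a closed set.\<close>

section \<open>Total functions recursive in an oracle\<close>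

text \<open>Sets of nodes replace nodes because both structures must be decidable although no path
  is known. The even sets have an obvious point, the empty set; the odd sets form an affine copy
  without one. A compatible choice of one odd set per level yields a path, as odd sets are nonempty.
  The tree branches infinitely: an approximate value comes from an unbounded supply of rational
  points, so compactness is of no help. Two obstacles shape the closed set. Exact identities between
  norms are not decidable; so each test sits in a gap. True data of precision 2^-k miss an identity
  by at most 3 * 2^-k, the test cuts at 4 * 2^-k with norms known up to 2^-k, and what passes misses
  it by at most 5 * 2^-k, which vanishes in the limit (2, 4 and 6 when two norms are compared).
  Density of the range is an existential statement; it becomes closed once the path itself carries a
  witness for each rational point and precision.\<close>

abbreviation pfst :: "nat \<Rightarrow> nat" where "pfst n \<equiv> fst (prod_decode n)"
abbreviation psnd :: "nat \<Rightarrow> nat" where "psnd n \<equiv> snd (prod_decode n)"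

definition recursive_in :: "nat set \<Rightarrow> (nat \<Rightarrow> nat) \<Rightarrow> bool" where
  "recursive_in A f \<longleftrightarrow> partial_recursive_in A (\<lambda>n. Some (f n))"

named_theorems rec_intros

lemma partial_recursive_in_mono:
  assumes "partial_recursive f"
  shows "partial_recursive_in A f"
proof (rule partial_recursive_in_trans[OF assms])
  show "turing_reducible {} A"
    using pr_zero[of A] by (simp add: turing_reducible_def)
qed

lemma recursive_in_mono: "recursive_in {} f \<Longrightarrow> recursive_in A f"
  by (simp add: recursive_in_def partial_recursive_in_mono)

lemma recursive_in_comp: "recursive_in A f \<Longrightarrow> recursive_in A g \<Longrightarrow> recursive_in A (\<lambda>n. f (g n))"
  using pr_comp[of A "\<lambda>n. Some (f n)" "\<lambda>n. Some (g n)"] by (simp add: recursive_in_def)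

lemma recursive_in_Suc [rec_intros]: "recursive_in A f \<Longrightarrow> recursive_in A (\<lambda>n. Suc (f n))"
  by (rule recursive_in_comp[of A Suc]) (use pr_succ in \<open>auto simp: recursive_in_def\<close>)

lemma recursive_in_pfst [rec_intros]: "recursive_in A f \<Longrightarrow> recursive_in A (\<lambda>n. pfst (f n))"
  by (rule recursive_in_comp[of A pfst]) (use pr_fst in \<open>auto simp: recursive_in_def\<close>)

lemma recursive_in_psnd [rec_intros]: "recursive_in A f \<Longrightarrow> recursive_in A (\<lambda>n. psnd (f n))"
  by (rule recursive_in_comp[of A psnd]) (use pr_snd in \<open>auto simp: recursive_in_def\<close>)

lemma recursive_in_prod_encode [rec_intros]:
  "recursive_in A f \<Longrightarrow> recursive_in A g \<Longrightarrow> recursive_in A (\<lambda>n. prod_encode (f n, g n))"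
  using pr_pair[of A "\<lambda>n. Some (f n)" "\<lambda>n. Some (g n)"] by (simp add: recursive_in_def)

lemma recursive_in_const [rec_intros]: "recursive_in A (\<lambda>n. c)"
proof (induction c)
  case 0
  then show ?case using pr_zero by (simp add: recursive_in_def)
qed (rule recursive_in_Suc)

lemma recursive_in_id [rec_intros]: "recursive_in A (\<lambda>n. n)"
  using recursive_in_prod_encode[of A pfst psnd] pr_fst[of A] pr_snd[of A]
  by (simp add: recursive_in_def)

text \<open>Later rules assume a body of two arguments in the packed form
  \<open>F (pfst z) (psnd z)\<close>; this rule instantiates it at computed arguments, so that no
  packing shows in the goal.\<close>

lemma recursive_in_comp2:
  assumes "recursive_in A (\<lambda>z. F (pfst z) (psnd z))" "recursive_in A g" "recursive_in A h"
  shows "recursive_in A (\<lambda>x. F (g x) (h x))"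
  using recursive_in_comp[OF assms(1) recursive_in_prod_encode[OF assms(2,3)]] by simp

lemma recursive_in_rec_nat [rec_intros]:
  assumes "recursive_in A f" "recursive_in A (\<lambda>z. g (pfst z) (pfst (psnd z)) (psnd (psnd z)))"
    and "recursive_in A h"
  shows "recursive_in A (\<lambda>x. rec_nat (f x) (g x) (h x))"
proof (rule recursive_in_comp2[of A "\<lambda>x n. rec_nat (f x) (g x) n" "\<lambda>x. x" h])
  have *: "rec_nat (Some (f a)) (\<lambda>k r. Option.bind r (\<lambda>y. Some (g a k y))) m
      = Some (rec_nat (f a) (g a) m)" for a m
    by (induction m) simp_all
  show "recursive_in A (\<lambda>z. rec_nat (f (pfst z)) (g (pfst z)) (psnd z))"
    using pr_primrec[of A "\<lambda>n. Some (f n)" "\<lambda>z. Some (g (pfst z) (pfst (psnd z)) (psnd (psnd z)))"]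
      assms(1,2) by (simp add: recursive_in_def *)
qed (use assms(3) in \<open>auto intro: rec_intros\<close>)

lemma minimization_total:
  assumes "\<exists>k. c k = 0"
  shows "minimization (\<lambda>k. Some (c k)) = Some (LEAST k. c k = 0)"
proof -
  have "\<exists>k. c k = 0 \<and> (\<forall>j<k. \<exists>y. c j = Suc y)"
    using LeastI_ex[OF assms] not_less_Least not0_implies_Suc by blast
  then show ?thesis by (simp add: minimization_def)
qed

lemma recursive_in_if_zero:
  assumes "recursive_in A p" "recursive_in A f" "recursive_in A g"
  shows "recursive_in A (\<lambda>x. if p x = 0 then f x else g x)"
proof -
  have "recursive_in A (\<lambda>x. rec_nat (f x) (\<lambda>_ _. g x) (p x))"
    by (intro rec_intros assms) (rule recursive_in_comp[OF assms(3)], intro rec_intros)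
  moreover have "rec_nat a (\<lambda>_ _. b) n = (if n = 0 then a else b)" for a b n :: nat
    by (cases n) simp_all
  ultimately show ?thesis by simp
qed

lemma recursive_in_if [rec_intros]:
  assumes "recursive_in A (\<lambda>x. of_bool (P x))" "recursive_in A f" "recursive_in A g"
  shows "recursive_in A (\<lambda>x. if P x then f x else g x)"
proof -
  have "(\<lambda>x. if P x then f x else g x) = (\<lambda>x. if of_bool (P x) = (0::nat) then g x else f x)"
    by (auto simp: fun_eq_iff)
  then show ?thesis using recursive_in_if_zero[OF assms(1,3,2)] by simp
qed

lemma recursive_in_neg [rec_intros]:
  assumes "recursive_in A (\<lambda>x. of_bool (P x))"
  shows "recursive_in A (\<lambda>x. of_bool (\<not> P x))"
proof -
  have "(\<lambda>x. of_bool (\<not> P x)) = (\<lambda>x. if P x then 0 else 1::nat)" by auto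
  then show ?thesis using recursive_in_if[OF assms recursive_in_const[of _ 0] recursive_in_const[of _ 1]] by simp
qed

lemma recursive_in_conj [rec_intros]:
  assumes "recursive_in A (\<lambda>x. of_bool (P x))" "recursive_in A (\<lambda>x. of_bool (Q x))"
  shows "recursive_in A (\<lambda>x. of_bool (P x \<and> Q x))"
proof -
  have "(\<lambda>x. of_bool (P x \<and> Q x)) = (\<lambda>x. if P x then of_bool (Q x) else 0::nat)" by auto
  then show ?thesis using recursive_in_if[OF assms recursive_in_const[of _ 0]] by simp
qed

lemma recursive_in_disj [rec_intros]:
  assumes "recursive_in A (\<lambda>x. of_bool (P x))" "recursive_in A (\<lambda>x. of_bool (Q x))"
  shows "recursive_in A (\<lambda>x. of_bool (P x \<or> Q x))"
proof -
  have "(\<lambda>x. of_bool (P x \<or> Q x)) = (\<lambda>x. if P x then 1::nat else of_bool (Q x))" by auto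
  then show ?thesis using recursive_in_if[OF assms(1) recursive_in_const[of _ 1] assms(2)] by simp
qed

lemma recursive_in_imp [rec_intros]:
  assumes "recursive_in A (\<lambda>x. of_bool (P x))" "recursive_in A (\<lambda>x. of_bool (Q x))"
  shows "recursive_in A (\<lambda>x. of_bool (P x \<longrightarrow> Q x))"
  unfolding imp_conv_disj by (intro rec_intros assms)

lemma recursive_in_iff [rec_intros]:
  assumes "recursive_in A (\<lambda>x. of_bool (P x))" "recursive_in A (\<lambda>x. of_bool (Q x))"
  shows "recursive_in A (\<lambda>x. of_bool (P x \<longleftrightarrow> Q x))"
  unfolding iff_conv_conj_imp by (intro rec_intros assms)

lemma recursive_in_add [rec_intros]:
  assumes "recursive_in A f" "recursive_in A g"
  shows "recursive_in A (\<lambda>x. f x + g x)"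
proof -
  have "recursive_in A (\<lambda>x. rec_nat (f x) (\<lambda>_ r. Suc r) (g x))"
    by (intro rec_intros assms)
  moreover have "rec_nat a (\<lambda>_ r. Suc r) n = a + n" for a n by (induction n) auto
  ultimately show ?thesis by simp
qed

lemma recursive_in_diff [rec_intros]:
  assumes "recursive_in A f" "recursive_in A g"
  shows "recursive_in A (\<lambda>x. f x - g x)"
proof -
  \<comment> \<open>The inner recursion is the predecessor: it returns its counter.\<close>
  have "recursive_in A (\<lambda>x. rec_nat (f x) (\<lambda>_ r. rec_nat 0 (\<lambda>k _. k) r) (g x))"
    by (intro rec_intros assms)
  moreover have "rec_nat 0 (\<lambda>k _. k) r = r - 1" for r by (cases r) auto
  moreover have "rec_nat a (\<lambda>_ r. r - 1) n = a - n" for a n by (induction n) auto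
  ultimately show ?thesis by simp
qed

lemma recursive_in_eq [rec_intros]:
  assumes "recursive_in A f" "recursive_in A g"
  shows "recursive_in A (\<lambda>x. of_bool (f x = g x))"
proof -
  have "recursive_in A (\<lambda>x. if f x - g x + (g x - f x) = 0 then 1 else 0)"
    by (rule recursive_in_if_zero) (intro rec_intros assms)+
  moreover have "(\<lambda>x. if f x - g x + (g x - f x) = 0 then 1 else 0::nat) = (\<lambda>x. of_bool (f x = g x))"
    by (auto simp: fun_eq_iff)
  ultimately show ?thesis by simp
qed

lemma recursive_in_le [rec_intros]:
  assumes "recursive_in A f" "recursive_in A g"
  shows "recursive_in A (\<lambda>x. of_bool (f x \<le> g x))"
proof -
  have "recursive_in A (\<lambda>x. of_bool (f x - g x = 0))"
    by (intro rec_intros assms)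
  then show ?thesis by simp
qed

lemma recursive_in_less [rec_intros]:
  assumes "recursive_in A f" "recursive_in A g"
  shows "recursive_in A (\<lambda>x. of_bool (f x < g x))"
  unfolding not_le[symmetric] by (intro rec_intros assms)

lemma recursive_in_sum [rec_intros]:
  assumes "recursive_in A (\<lambda>z. g (pfst z) (psnd z))" "recursive_in A h"
  shows "recursive_in A (\<lambda>x. \<Sum>i<h x. g x i)"
proof -
  have "recursive_in A (\<lambda>x. rec_nat 0 (\<lambda>i r. r + g x i) (h x))"
    by (intro rec_intros assms) (rule recursive_in_comp2[OF assms(1)]; intro rec_intros)
  moreover have "rec_nat 0 (\<lambda>i r. r + g x i) n = (\<Sum>i<n. g x i)" for x n
    by (induction n) auto
  ultimately show ?thesis by simp
qed

lemma recursive_in_mult [rec_intros]: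
  assumes "recursive_in A f" "recursive_in A g"
  shows "recursive_in A (\<lambda>x. f x * g x)"
proof -
  have "recursive_in A (\<lambda>x. \<Sum>i<f x. g x)"
    by (intro rec_intros assms) (rule recursive_in_comp[OF assms(2)], intro rec_intros)
  then show ?thesis by simp
qed

lemma recursive_in_power [rec_intros]:
  assumes "recursive_in A f" "recursive_in A g"
  shows "recursive_in A (\<lambda>x. f x ^ g x)"
proof -
  have "recursive_in A (\<lambda>x. rec_nat (Suc 0) (\<lambda>_ r. f x * r) (g x))"
    by (intro rec_intros assms) (rule recursive_in_comp[OF assms(1)], intro rec_intros)
  moreover have "rec_nat (Suc 0) (\<lambda>_ r. a * r) n = a ^ n" for a n by (induction n) auto
  ultimately show ?thesis by simp
qed

lemma recursive_in_ball [rec_intros]: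
  assumes "recursive_in A (\<lambda>z. of_bool (P (pfst z) (psnd z)))" "recursive_in A h"
  shows "recursive_in A (\<lambda>x. of_bool (\<forall>i<h x. P x i))"
proof -
  have "(\<lambda>x. of_bool (\<forall>i<h x. P x i) :: nat) =
      (\<lambda>x. of_bool ((\<Sum>i<h x. of_bool (\<not> P x i)) = (0::nat)))"
    by (auto simp: fun_eq_iff)
  moreover have "recursive_in A \<dots>"
    by (intro rec_intros assms)
  ultimately show ?thesis by (simp only:)
qed

lemma recursive_in_div [rec_intros]:
  assumes "recursive_in A f" "recursive_in A g"
  shows "recursive_in A (\<lambda>x. f x div g x)"
proof (rule recursive_in_comp2[OF _ assms])
  \<comment> \<open>The quotient counts the positive multiples of \<open>b\<close> up to
    \<open>a\<close>; as \<open>b\<close> is positive, there are at most \<open>a\<close> of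
    them.\<close>
  have "(\<Sum>q<a. of_bool (Suc q * b \<le> a)) = a div b" if "b > 0" for a b :: nat
  proof -
    have "Suc q * b \<le> a \<longleftrightarrow> q < a div b" for q
      using that by (metis Suc_le_eq less_eq_div_iff_mult_less_eq)
    moreover have "{..<a} \<inter> {q. q < a div b} = {..<a div b}"
      using div_le_dividend[of a b] by (auto intro: less_le_trans)
    ultimately show ?thesis by (simp only: sum_of_bool_eq finite_lessThan) simp
  qed
  then have "(\<lambda>z. pfst z div psnd z) =
      (\<lambda>z. if psnd z = 0 then 0 else \<Sum>q<pfst z. of_bool (Suc q * psnd z \<le> pfst z))"
    by (auto simp: fun_eq_iff)
  moreover have "recursive_in A \<dots>"
    by (intro rec_intros)
  ultimately show "recursive_in A (\<lambda>z. pfst z div psnd z)" by simp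
qed

lemma recursive_in_mod [rec_intros]:
  assumes "recursive_in A f" "recursive_in A g"
  shows "recursive_in A (\<lambda>x. f x mod g x)"
  unfolding modulo_nat_def by (intro rec_intros assms)

lemma recursive_in_even [rec_intros]:
  assumes "recursive_in A f"
  shows "recursive_in A (\<lambda>x. of_bool (even (f x)))"
  unfolding even_iff_mod_2_eq_zero by (intro rec_intros assms)

lemma recursive_in_Least:
  assumes "recursive_in A (\<lambda>z. of_bool (P (pfst z) (psnd z)))" "\<And>x. \<exists>k. P x k"
  shows "recursive_in A (\<lambda>x. LEAST k. P x k)"
proof -
  have "recursive_in A (\<lambda>z. of_bool (\<not> P (pfst z) (psnd z)))"
    by (intro rec_intros assms)
  then have "partial_recursive_in A (\<lambda>x. minimization (\<lambda>k. Some (of_bool (\<not> P x k))))"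
    using pr_min[of A "\<lambda>z. Some (of_bool (\<not> P (pfst z) (psnd z)))"] by (simp add: recursive_in_def)
  moreover have "minimization (\<lambda>k. Some (of_bool (\<not> P x k))) = Some (LEAST k. P x k)" for x
    using minimization_total[of "\<lambda>k. of_bool (\<not> P x k)"] assms(2) by simp
  ultimately show ?thesis by (simp add: recursive_in_def)
qed

section \<open>Stage approximations of partial recursive functions\<close>

text \<open>The value \<open>Suc y\<close> at stage \<open>t\<close> announces that the computation on \<open>n\<close> has halted with
  output \<open>y\<close>, and \<open>0\<close> that it has not halted yet.\<close>

definition stage_approx :: "nat set \<Rightarrow> (nat \<rightharpoonup> nat) \<Rightarrow> (nat \<Rightarrow> nat \<Rightarrow> nat) \<Rightarrow> bool" where
  "stage_approx A f F \<longleftrightarrow> recursive_in A (\<lambda>z. F (pfst z) (psnd z)) \<and>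
     (\<forall>n t u. F n t \<noteq> 0 \<longrightarrow> t \<le> u \<longrightarrow> F n u = F n t) \<and>
     (\<forall>n y. f n = Some y \<longleftrightarrow> (\<exists>t. F n t = Suc y))"

lemma stage_approxI:
  assumes "recursive_in A (\<lambda>z. F (pfst z) (psnd z))"
    and "\<And>n t u y. F n t = Suc y \<Longrightarrow> t \<le> u \<Longrightarrow> F n u = Suc y"
    and "\<And>n t y. F n t = Suc y \<Longrightarrow> f n = Some y"
    and "\<And>n y. f n = Some y \<Longrightarrow> \<exists>t. F n t = Suc y"
  shows "stage_approx A f F"
  unfolding stage_approx_def using assms by (metis not0_implies_Suc)

lemma stage_approx_mono: "stage_approx A f F \<Longrightarrow> F n t = Suc y \<Longrightarrow> t \<le> u \<Longrightarrow> F n u = Suc y"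
  unfolding stage_approx_def by (metis Zero_neq_Suc)

lemma stage_approx_sound: "stage_approx A f F \<Longrightarrow> F n t = Suc y \<Longrightarrow> f n = Some y"
  unfolding stage_approx_def by metis

lemma stage_approx_complete: "stage_approx A f F \<Longrightarrow> f n = Some y \<Longrightarrow> \<exists>t. F n t = Suc y"
  unfolding stage_approx_def by metis

lemma stage_approx_recursive:
  "stage_approx A f F \<Longrightarrow> recursive_in A g \<Longrightarrow> recursive_in A h \<Longrightarrow> recursive_in A (\<lambda>x. F (g x) (h x))"
  unfolding stage_approx_def by (metis recursive_in_comp2)

lemma stage_approx_total:
  assumes "recursive_in A f"
  shows "stage_approx A (\<lambda>n. Some (f n)) (\<lambda>n t. Suc (f n))"
  by (rule stage_approxI) (auto intro!: recursive_in_Suc recursive_in_comp[OF assms] recursive_in_pfst recursive_in_id)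

text \<open>Each scheme runs all its subcomputations for the same number of stages. Halting thus
  becomes observable by a total function, and a single search can dovetail a partial algorithm over
  infinitely many inputs. No universal machine is involved, since every function receives its own
  approximation.\<close>

lemma stage_approx_exists:
  assumes "partial_recursive_in A f"
  shows "\<exists>F. stage_approx A f F"
  using assms
proof induction
  case (pr_pair f g)
  then obtain F G where F: "stage_approx A f F" and G: "stage_approx A g G" by blast
  show ?case
  proof (rule exI, rule stage_approxI)
    let ?H = "\<lambda>n t. if F n t = 0 \<or> G n t = 0 then 0
                else Suc (prod_encode (F n t - 1, G n t - 1))"
    show "recursive_in A (\<lambda>z. ?H (pfst z) (psnd z))"
      by (intro rec_intros stage_approx_recursive[OF F] stage_approx_recursive[OF G])
    show "?H n u = Suc y" if "?H n t = Suc y" "t \<le> u" for n t u y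
      using that stage_approx_mono[OF F _ that(2), of n] stage_approx_mono[OF G _ that(2), of n]
      by (cases "F n t"; cases "G n t") auto
    show "Option.bind (f n) (\<lambda>x. Option.bind (g n) (\<lambda>y. Some (prod_encode (x, y)))) = Some y"
      if "?H n t = Suc y" for n t y
      using that stage_approx_sound[OF F, of n t] stage_approx_sound[OF G, of n t]
      by (cases "F n t"; cases "G n t") auto
    show "\<exists>t. ?H n t = Suc y"
      if "Option.bind (f n) (\<lambda>x. Option.bind (g n) (\<lambda>y. Some (prod_encode (x, y)))) = Some y" for n y
    proof -
      from that obtain a b where ab: "f n = Some a" "g n = Some b" "y = prod_encode (a, b)"
        by (auto simp: bind_eq_Some_conv)
      obtain t u where "F n t = Suc a" "G n u = Suc b"
        using stage_approx_complete[OF F ab(1)] stage_approx_complete[OF G ab(2)] by blast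
      then have "F n (max t u) = Suc a" "G n (max t u) = Suc b"
        using stage_approx_mono[OF F, of n t a "max t u"] stage_approx_mono[OF G, of n u b "max t u"]
        by auto
      then show ?thesis using ab(3) by (intro exI[of _ "max t u"]) simp
    qed
  qed
next
  case (pr_comp f g)
  then obtain F G where F: "stage_approx A f F" and G: "stage_approx A g G" by blast
  show ?case
  proof (rule exI, rule stage_approxI)
    let ?H = "\<lambda>n t. if G n t = 0 then 0 else F (G n t - 1) t"
    show "recursive_in A (\<lambda>z. ?H (pfst z) (psnd z))"
      by (intro rec_intros stage_approx_recursive[OF F] stage_approx_recursive[OF G])
    show "?H n u = Suc y" if "?H n t = Suc y" "t \<le> u" for n t u y
      using that stage_approx_mono[OF G _ that(2), of n] stage_approx_mono[OF F _ that(2)]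
      by (cases "G n t") auto
    show "Option.bind (g n) f = Some y" if "?H n t = Suc y" for n t y
      using that stage_approx_sound[OF G, of n t] stage_approx_sound[OF F, of _ t y]
      by (cases "G n t") auto
    show "\<exists>t. ?H n t = Suc y" if y: "Option.bind (g n) f = Some y" for n y
    proof -
      from y obtain a where ab: "g n = Some a" "f a = Some y"
        by (auto simp: bind_eq_Some_conv)
      obtain t u where "G n t = Suc a" "F a u = Suc y"
        using stage_approx_complete[OF G ab(1)] stage_approx_complete[OF F ab(2)] by blast
      then have "G n (max t u) = Suc a" "F a (max t u) = Suc y"
        using stage_approx_mono[OF G, of n t a "max t u"] stage_approx_mono[OF F, of a u y "max t u"]
        by auto
      then show ?thesis by (intro exI[of _ "max t u"]) simp
    qed
  qed
next
  case (pr_primrec f g)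
  then obtain F G where F: "stage_approx A f F" and G: "stage_approx A g G" by blast
  let ?R = "\<lambda>a t. rec_nat (F a t)
      (\<lambda>k r. if r = 0 then 0 else G (prod_encode (a, prod_encode (k, r - 1))) t)"
  let ?r = "\<lambda>a. rec_nat (f a) (\<lambda>k r. Option.bind r (\<lambda>y. g (prod_encode (a, prod_encode (k, y)))))"
  show ?case
  proof (rule exI, rule stage_approxI)
    show "recursive_in A (\<lambda>z. ?R (pfst (pfst z)) (psnd z) (psnd (pfst z)))"
      by (intro rec_intros stage_approx_recursive[OF F] stage_approx_recursive[OF G])
    show mono: "?R (pfst n) u (psnd n) = Suc y"
      if "?R (pfst n) t (psnd n) = Suc y" "t \<le> u" for n t u y
    proof -
      have "?R a u m = Suc y" if "?R a t m = Suc y" "t \<le> u" for a m y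
        using that
      proof (induction m arbitrary: y)
        case 0
        then show ?case using stage_approx_mono[OF F _ \<open>t \<le> u\<close>] by simp
      next
        case (Suc m)
        then show ?case
          using stage_approx_mono[OF G _ \<open>t \<le> u\<close>] by (cases "?R a t m") simp_all
      qed
      then show ?thesis using that by blast
    qed
    show "?r (pfst n) (psnd n) = Some y" if "?R (pfst n) t (psnd n) = Suc y" for n t y
    proof -
      have "?r a m = Some y" if "?R a t m = Suc y" for a m y
        using that
      proof (induction m arbitrary: y)
        case 0
        then show ?case using stage_approx_sound[OF F, of a t y] by simp
      next
        case (Suc m)
        then show ?case
          using stage_approx_sound[OF G, of _ t y] by (cases "?R a t m") auto
      qed
      then show ?thesis using that by blast
    qed
    show "\<exists>t. ?R (pfst n) t (psnd n) = Suc y" if "?r (pfst n) (psnd n) = Some y" for n y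
    proof -
      have "\<exists>t. ?R a t m = Suc y" if "?r a m = Some y" for a m y
        using that
      proof (induction m arbitrary: y)
        case 0
        then show ?case using stage_approx_complete[OF F, of a y] by simp
      next
        case (Suc m)
        then obtain b where b: "?r a m = Some b" "g (prod_encode (a, prod_encode (m, b))) = Some y"
          by (auto simp: bind_eq_Some_conv)
        obtain t u where tu: "?R a t m = Suc b" "G (prod_encode (a, prod_encode (m, b))) u = Suc y"
          using Suc.IH[OF b(1)] stage_approx_complete[OF G b(2)] by blast
        have "?R a (max t u) m = Suc b"
          using mono[of "prod_encode (a, m)" t b "max t u", unfolded prod_encode_inverse fst_conv snd_conv,
              OF tu(1)] by simp
        moreover have "G (prod_encode (a, prod_encode (m, b))) (max t u) = Suc y"
          using stage_approx_mono[OF G tu(2), of "max t u"] by simp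
        ultimately show ?case by (intro exI[of _ "max t u"]) simp
      qed
      then show ?thesis using that by blast
    qed
  qed
next
  case (pr_min f)
  then obtain F where F: "stage_approx A f F" by blast
  \<comment> \<open>A stage value of 1 announces output 0, and one of at least 2 announces a
    positive output. So \<open>?c\<close> says that by stage \<open>t\<close> the search is seen to
    end at \<open>k\<close>. At most one \<open>k\<close> qualifies, and the sum \<open>?H\<close>
    picks out its successor.\<close>
  let ?c = "\<lambda>n t k. F (prod_encode (n, k)) t = 1 \<and> (\<forall>j<k. 2 \<le> F (prod_encode (n, j)) t)"
  let ?H = "\<lambda>n t. \<Sum>k<t. of_bool (?c n t k) * Suc k"
  have unique: "k = l" if "?c n t k" "?c n t l" for n t k l
    using that by (metis linorder_neqE_nat numeral_le_one_iff semiring_norm(69))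
  have H: "?H n t = Suc y \<longleftrightarrow> y < t \<and> ?c n t y" for n t y
  proof -
    have val: "?H n t = Suc k" if "k < t" "?c n t k" for k
    proof -
      have "?H n t = (\<Sum>i\<in>{k}. of_bool (?c n t i) * Suc i)"
      proof (rule sum.mono_neutral_right)
        show "\<forall>i\<in>{..<t} - {k}. of_bool (?c n t i) * Suc i = 0"
        proof
          fix i assume "i \<in> {..<t} - {k}"
          then have "\<not> ?c n t i" using unique[OF _ that(2)] by blast
          then show "of_bool (?c n t i) * Suc i = 0" by (simp only: of_bool_eq mult_zero_left)
        qed
      qed (use that(1) in auto)
      then show ?thesis using that by simp
    qed
    have ex: "\<exists>k<t. ?c n t k" if "?H n t = Suc y"
    proof (rule ccontr)
      assume "\<not> ?thesis"
      then have none: "\<not> ?c n t k" if "k < t" for k using that by blast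
      have "?H n t = 0"
        by (intro sum.neutral ballI) (use none in \<open>simp only: lessThan_iff of_bool_eq mult_zero_left\<close>)
      then show False using that by (simp only: nat.distinct)
    qed
    show ?thesis
    proof
      assume H: "?H n t = Suc y"
      then obtain k where k: "k < t" "?c n t k" using ex by blast
      then have "k = y" using val[OF k] H by (simp only: nat.inject)
      then show "y < t \<and> ?c n t y" using k by blast
    qed (use val in blast)
  qed
  have stages: "\<exists>t. \<forall>j<k. 2 \<le> F (prod_encode (n, j)) t"
    if "\<forall>j<k. \<exists>y. f (prod_encode (n, j)) = Some (Suc y)" for n k
    using that
  proof (induction k)
    case (Suc k)
    then obtain t y where t: "\<forall>j<k. 2 \<le> F (prod_encode (n, j)) t"
      and y: "f (prod_encode (n, k)) = Some (Suc y)"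
      by (meson less_Suc_eq)
    obtain u where u: "F (prod_encode (n, k)) u = Suc (Suc y)"
      using stage_approx_complete[OF F y] by blast
    have "2 \<le> F (prod_encode (n, j)) (max t u)" if "j < Suc k" for j
    proof (cases "j = k")
      case True
      then show ?thesis using stage_approx_mono[OF F u, of "max t u"] by simp
    next
      case False
      then have "2 \<le> F (prod_encode (n, j)) t" using t that by simp
      then show ?thesis
        using stage_approx_mono[OF F, of "prod_encode (n, j)" t _ "max t u"]
        by (cases "F (prod_encode (n, j)) t") auto
    qed
    then show ?case by blast
  qed simp
  have min: "minimization (\<lambda>k. f (prod_encode (n, k))) = Some y \<longleftrightarrow>
      f (prod_encode (n, y)) = Some 0 \<and> (\<forall>j<y. \<exists>v. f (prod_encode (n, j)) = Some (Suc v))"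
    (is "_ \<longleftrightarrow> ?Q y") for n y
  proof -
    have "(LEAST k. f (prod_encode (n, k)) = Some 0) = k" if "?Q k" for k
      by (rule Least_equality) (use that in \<open>auto simp: not_less[symmetric]\<close>)
    then show ?thesis by (auto simp: minimization_def)
  qed
  show ?case
  proof (rule exI, rule stage_approxI)
    show "recursive_in A (\<lambda>z. ?H (pfst z) (psnd z))"
      by (intro rec_intros stage_approx_recursive[OF F])
    show "?H n u = Suc y" if "?H n t = Suc y" "t \<le> u" for n t u y
    proof -
      from that(1) have y: "y < t" "F (prod_encode (n, y)) t = 1"
        and j: "\<forall>j<y. 2 \<le> F (prod_encode (n, j)) t" unfolding H by auto
      have "F (prod_encode (n, y)) u = 1"
        using y(2) stage_approx_mono[OF F _ that(2), of "prod_encode (n, y)" 0] by simp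
      moreover have "2 \<le> F (prod_encode (n, i)) u" if "i < y" for i
        using j that stage_approx_mono[OF F _ \<open>t \<le> u\<close>, of "prod_encode (n, i)"]
        by (cases "F (prod_encode (n, i)) t") auto
      ultimately show ?thesis using y(1) that(2) unfolding H by auto
    qed
    show "minimization (\<lambda>k. f (prod_encode (n, k))) = Some y" if "?H n t = Suc y" for n t y
    proof -
      from that have y: "F (prod_encode (n, y)) t = Suc 0"
        and j: "\<forall>j<y. 2 \<le> F (prod_encode (n, j)) t" unfolding H by auto
      have "\<exists>v. f (prod_encode (n, i)) = Some (Suc v)" if "i < y" for i
      proof -
        have "F (prod_encode (n, i)) t = Suc (Suc (F (prod_encode (n, i)) t - 2))"
          using j that by fastforce
        then show ?thesis using stage_approx_sound[OF F] by blast
      qed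
      then show ?thesis using stage_approx_sound[OF F y] unfolding min by simp
    qed
    show "\<exists>t. ?H n t = Suc y" if "minimization (\<lambda>k. f (prod_encode (n, k))) = Some y" for n y
    proof -
      from that have y: "f (prod_encode (n, y)) = Some 0"
        and "\<forall>j<y. \<exists>v. f (prod_encode (n, j)) = Some (Suc v)" unfolding min by auto
      then obtain t where t: "\<forall>j<y. 2 \<le> F (prod_encode (n, j)) t" using stages by blast
      obtain u where u: "F (prod_encode (n, y)) u = Suc 0"
        using stage_approx_complete[OF F y] by blast
      \<comment> \<open>\<open>?H\<close> only searches below the stage, so the stage has to exceed
        \<open>y\<close> as well.\<close>
      let ?m = "max (max t u) (Suc y)"
      have "F (prod_encode (n, y)) ?m = 1"
        using stage_approx_mono[OF F u, of ?m] by simp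
      moreover have "2 \<le> F (prod_encode (n, i)) ?m" if "i < y" for i
        using t that stage_approx_mono[OF F, of "prod_encode (n, i)" t _ ?m]
        by (cases "F (prod_encode (n, i)) t") auto
      ultimately have "?H n ?m = Suc y" unfolding H by auto
      then show ?thesis by blast
    qed
  qed
qed (use stage_approx_total in \<open>auto intro: rec_intros simp: recursive_in_def
        intro!: exI stage_approx_total partial_recursive_in.intros\<close>)

section \<open>Lowness for paths\<close>

text \<open>The latest value stands in front, in the format of \<open>list_encode\<close>, so that
  the tail of a history is its parent in the tree.\<close>

primrec history :: "(nat \<Rightarrow> nat) \<Rightarrow> nat \<Rightarrow> nat" where
  "history g 0 = 0"
| "history g (Suc n) = Suc (prod_encode (g n, history g n))"

lemma history_rec_nat: "history g n = rec_nat 0 (\<lambda>k r. Suc (prod_encode (g k, r))) n"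
  by (induction n) auto

lemma recursive_in_history:
  assumes "recursive_in A g" "recursive_in A f"
  shows "recursive_in A (\<lambda>x. history g (f x))"
  unfolding history_rec_nat
  by (intro rec_intros assms(2)) (rule recursive_in_comp[OF assms(1)], intro rec_intros)

text \<open>With this bound, quantification and counting over a coded set are bounded, hence
  recursive.\<close>

lemma set_decode_subset_lessThan: "set_decode x \<subseteq> {..<x}"
proof
  fix i assume "i \<in> set_decode x"
  then have "2 ^ i \<le> x"
    by (metis div_less dvd_0_right mem_Collect_eq not_le set_decode_def)
  then show "i \<in> {..<x}"
    using order.strict_trans2[OF less_exp] by blast
qed

lemma recursive_in_set_decode [rec_intros]:
  assumes "recursive_in A f" "recursive_in A g"
  shows "recursive_in A (\<lambda>x. of_bool (f x \<in> set_decode (g x)))"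
  unfolding set_decode_def mem_Collect_eq by (intro rec_intros assms)

lemma recursive_in_ball_set_decode [rec_intros]:
  assumes "recursive_in A (\<lambda>z. of_bool (P (pfst z) (psnd z)))" "recursive_in A f"
  shows "recursive_in A (\<lambda>x. of_bool (\<forall>i\<in>set_decode (f x). P x i))"
proof -
  have "recursive_in A (\<lambda>x. of_bool (\<forall>i<f x. i \<in> set_decode (f x) \<longrightarrow> P x i))"
    by (intro rec_intros assms recursive_in_comp[OF assms(2)])
  moreover have "(\<forall>i<n. i \<in> set_decode n \<longrightarrow> Q i) \<longleftrightarrow> (\<forall>i\<in>set_decode n. Q i)" for n Q
    using set_decode_subset_lessThan[of n] by auto
  ultimately show ?thesis by simp
qed

lemma recursive_in_odd_card_set_decode [rec_intros]:
  assumes "recursive_in A (\<lambda>z. of_bool (P (pfst z) (psnd z)))" "recursive_in A f"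
  shows "recursive_in A (\<lambda>x. of_bool (odd (card {i \<in> set_decode (f x). P x i})))"
proof -
  have "recursive_in A (\<lambda>x. of_bool (\<not> even (\<Sum>i<f x. of_bool (i \<in> set_decode (f x) \<and> P x i) :: nat)))"
    by (intro rec_intros assms recursive_in_comp[OF assms(2)])
  moreover have "(\<Sum>i<n. of_bool (i \<in> set_decode n \<and> Q i)) = card {i \<in> set_decode n. Q i}" for n Q
  proof -
    have "{..<n} \<inter> {i. i \<in> set_decode n \<and> Q i} = {i \<in> set_decode n. Q i}"
      using set_decode_subset_lessThan[of n] by auto
    then show ?thesis by simp
  qed
  ultimately show ?thesis by simp
qed

text \<open>Addition of the basis vector \<open>i\<close> over the two-element field, carried out on
  the binary digits of a set code.\<close>

definition toggle :: "nat \<Rightarrow> nat \<Rightarrow> nat" where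
  "toggle x i = (if i \<in> set_decode x then x - 2 ^ i else x + 2 ^ i)"

lemma recursive_in_toggle [rec_intros]:
  assumes "recursive_in A f" "recursive_in A g"
  shows "recursive_in A (\<lambda>x. toggle (f x) (g x))"
  unfolding toggle_def by (intro rec_intros assms)

lemma set_decode_toggle: "set_decode (toggle x i) = sym_diff (set_decode x) {i}"
proof (cases "i \<in> set_decode x")
  case True
  have "x = set_encode (insert i (set_decode x - {i}))"
    using True by (simp add: insert_absorb)
  also have "\<dots> = 2 ^ i + set_encode (set_decode x - {i})"
    by (rule set_encode_insert) auto
  finally have "toggle x i = set_encode (set_decode x - {i})"
    using True by (simp add: toggle_def)
  then show ?thesis using True by auto
next
  case False
  have "set_encode (insert i (set_decode x)) = 2 ^ i + x"
    using False by (simp add: set_encode_insert)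
  then have "toggle x i = set_encode (insert i (set_decode x))"
    using False by (simp add: toggle_def)
  then have "set_decode (toggle x i) = insert i (set_decode x)"
    by (simp only: set_encode_inverse finite_insert finite_set_decode)
  then show ?thesis using False by auto
qed

lemma toggle_toggle [simp]: "toggle (toggle x i) i = x"
proof -
  have "set_decode (toggle (toggle x i) i) = set_decode x"
    by (auto simp: set_decode_toggle)
  then show ?thesis by (metis set_decode_inverse)
qed

lemma odd_card_imp_ex_mem: "odd (card S) \<Longrightarrow> \<exists>x. x \<in> S"
  by (metis card.empty even_zero ex_in_conv)

lemma odd_card_sym_diff_singleton:
  assumes "finite S"
  shows "odd (card (sym_diff S {i})) \<longleftrightarrow> even (card S)"
proof (cases "i \<in> S")
  case True
  then have "sym_diff S {i} = S - {i}" "card S = Suc (card (S - {i}))"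
    using card.remove[OF assms True] by auto
  then show ?thesis by simp
next
  case False
  then have "sym_diff S {i} = insert i S" by auto
  then show ?thesis using assms False by simp
qed

text \<open>A nonzero \<open>\<tau>\<close> codes a nonempty list whose tail has code \<open>psnd (\<tau> - 1)\<close>.  On the vector
  spaces over the two-element field spanned by the codes, taking tails induces a linear map,
  of which this is the graph.\<close>

definition push_forward :: "nat \<Rightarrow> nat \<Rightarrow> bool" where
  "push_forward x y \<longleftrightarrow>
     (\<forall>\<sigma>. \<sigma> \<in> set_decode y \<longleftrightarrow> odd (card {\<tau> \<in> set_decode x. \<tau> \<noteq> 0 \<and> psnd (\<tau> - 1) = \<sigma>}))"

text \<open>A set code exceeds the elements of the set, and the tail of a nonempty list has a
  smaller code than the list. So for large \<open>\<sigma>\<close> both sides of the equivalence are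
  false, and the condition is decidable.\<close>

lemma push_forward_bounded:
  "push_forward x y \<longleftrightarrow>
    (\<forall>\<sigma><x + y. \<sigma> \<in> set_decode y \<longleftrightarrow> odd (card {\<tau> \<in> set_decode x. \<tau> \<noteq> 0 \<and> psnd (\<tau> - 1) = \<sigma>}))"
proof -
  have "\<sigma> < x" if "odd (card {\<tau> \<in> set_decode x. \<tau> \<noteq> 0 \<and> psnd (\<tau> - 1) = \<sigma>})" for \<sigma>
  proof -
    from odd_card_imp_ex_mem[OF that] obtain \<tau> where "\<tau> \<in> set_decode x" "psnd (\<tau> - 1) = \<sigma>"
      by blast
    moreover have "psnd (\<tau> - 1) \<le> \<tau> - 1"
      by (metis le_prod_encode_2 prod.collapse prod_decode_inverse)
    ultimately show ?thesis using set_decode_subset_lessThan[of x] by fastforce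
  qed
  moreover have "\<sigma> < y" if "\<sigma> \<in> set_decode y" for \<sigma>
    using set_decode_subset_lessThan that by auto
  ultimately show ?thesis unfolding push_forward_def by (meson trans_less_add1 trans_less_add2)
qed

lemma recursive_in_push_forward [rec_intros]:
  assumes "recursive_in A f" "recursive_in A g"
  shows "recursive_in A (\<lambda>x. of_bool (push_forward (f x) (g x)))"
  by (rule recursive_in_comp2[OF _ assms]) (unfold push_forward_bounded, intro rec_intros)

text \<open>Linearity: adding a basis vector to the argument adds its tail to the value. A
  translation by nodes that are successive tails therefore preserves the graph.\<close>

lemma push_forward_toggle:
  assumes "\<tau> \<noteq> 0"
  shows "push_forward (toggle x \<tau>) (toggle y (psnd (\<tau> - 1))) \<longleftrightarrow> push_forward x y"
proof -
  have *: "{\<tau>' \<in> sym_diff S {\<tau>}. \<tau>' \<noteq> 0 \<and> psnd (\<tau>' - 1) = \<sigma>} =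
      (if psnd (\<tau> - 1) = \<sigma> then sym_diff {\<tau>' \<in> S. \<tau>' \<noteq> 0 \<and> psnd (\<tau>' - 1) = \<sigma>} {\<tau>}
       else {\<tau>' \<in> S. \<tau>' \<noteq> 0 \<and> psnd (\<tau>' - 1) = \<sigma>})" for S \<sigma>
    using assms by auto
  have "odd (card {\<tau>' \<in> set_decode (toggle x \<tau>). \<tau>' \<noteq> 0 \<and> psnd (\<tau>' - 1) = \<sigma>}) \<longleftrightarrow>
      (odd (card {\<tau>' \<in> set_decode x. \<tau>' \<noteq> 0 \<and> psnd (\<tau>' - 1) = \<sigma>}) \<noteq> (psnd (\<tau> - 1) = \<sigma>))" for \<sigma>
    using odd_card_sym_diff_singleton[of "{\<tau>' \<in> set_decode x. \<tau>' \<noteq> 0 \<and> psnd (\<tau>' - 1) = \<sigma>}" \<tau>]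
    unfolding set_decode_toggle * by simp
  moreover have "\<sigma> \<in> set_decode (toggle y (psnd (\<tau> - 1))) \<longleftrightarrow>
      ((\<sigma> \<in> set_decode y) \<noteq> (psnd (\<tau> - 1) = \<sigma>))" for \<sigma>
    by (auto simp: set_decode_toggle)
  ultimately show ?thesis unfolding push_forward_def by blast
qed

section \<open>The two structures of a tree\<close>

definition path_language :: language where
  "path_language = \<lparr>rel_symbols = UNIV, rel_arity = \<lambda>_. 2, fun_symbols = {}, fun_arity = \<lambda>_. 0,
     const_symbols = {}\<rparr>"

text \<open>An element is a level paired with a set of nodes, whose parity is \<open>b\<close>.
  Relation \<open>k\<close> prescribes the levels of both arguments; this is what forces an
  isomorphism to keep the level of the empty sets. Nodes at level \<open>n\<close> need not be lists
  of length \<open>n\<close>: only level 0 is restricted to the empty history, and lengths come out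
  right along chains of tails that start there.\<close>

definition path_structure :: "(nat \<Rightarrow> nat \<Rightarrow> bool) \<Rightarrow> bool \<Rightarrow> countable_structure" where
  "path_structure R b =
     \<lparr>universe = {z. (odd (card (set_decode (psnd z))) \<longleftrightarrow> b) \<and>
        (\<forall>\<sigma>\<in>set_decode (psnd z). R (pfst z) \<sigma> \<and> (pfst z = 0 \<longrightarrow> \<sigma> = 0))},
      rel_interp = \<lambda>k xs. pfst (xs ! 0) = Suc k \<and> pfst (xs ! 1) = k \<and>
        push_forward (psnd (xs ! 0)) (psnd (xs ! 1)),
      fun_interp = \<lambda>_ _. 0, const_interp = \<lambda>_. 0\<rparr>"

lemma tuples_2: "tuples D 2 = {[a, b] | a b. a \<in> D \<and> b \<in> D}"
  by (auto simp: tuples_def length_Suc_conv numeral_2_eq_2)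

lemma computable_path_language: "computable_language path_language"
  using recursive_in_const[of "{}" 0] recursive_in_const[of "{}" 1] recursive_in_const[of "{}" 2]
  by (auto simp: computable_language_def path_language_def decidable_def recursive_in_def)

lemma computable_path_structure:
  assumes "recursive_in {} (\<lambda>z. of_bool (R (pfst z) (psnd z)))"
  shows "computable_structure path_language (path_structure R b)"
proof -
  have "recursive_in {} (\<lambda>z. of_bool (odd (card {i \<in> set_decode (psnd z). True})))"
    by (rule recursive_in_odd_card_set_decode) (intro rec_intros)+
  then have card: "recursive_in {} (\<lambda>z. of_bool (odd (card (set_decode (psnd z)))))" by simp
  have "recursive_in {} (\<lambda>z. of_bool ((\<not> even (card (set_decode (psnd z))) \<longleftrightarrow> b) \<and>
        (\<forall>\<sigma>\<in>set_decode (psnd z). R (pfst z) \<sigma> \<and> (pfst z = 0 \<longrightarrow> \<sigma> = 0))))"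
    by (rule recursive_in_conj, rule recursive_in_iff, rule card)
      (intro rec_intros recursive_in_comp2[OF assms])+
  then have dec: "decidable (universe (path_structure R b))"
    by (simp add: decidable_def path_structure_def recursive_in_def)
  let ?a = "\<lambda>z. pfst (psnd z - 1)" and ?b = "\<lambda>z. pfst (psnd (psnd z - 1) - 1)"
  have "recursive_in {} (\<lambda>z. of_bool (pfst (?a z) = Suc (pfst z) \<and> pfst (?b z) = pfst z \<and>
        push_forward (psnd (?a z)) (psnd (?b z))))"
    by (intro rec_intros)
  then have "partial_recursive (\<lambda>z. Some (of_bool (pfst (?a z) = Suc (pfst z) \<and>
        pfst (?b z) = pfst z \<and> push_forward (psnd (?a z)) (psnd (?b z)))))"
    by (simp add: recursive_in_def)
  then have "\<exists>g. partial_recursive g \<and> (\<forall>r xs. xs \<in> tuples (universe (path_structure R b)) 2 \<longrightarrow>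
           g (prod_encode (r, list_encode xs)) = Some (of_bool (rel_interp (path_structure R b) r xs)))"
    by (intro exI conjI) (auto simp: tuples_2 path_structure_def)
  moreover have "\<exists>g. partial_recursive g" using pr_zero by blast
  ultimately show ?thesis
    using dec unfolding computable_structure_def structure_for_def path_language_def
      language.simps by blast
qed

text \<open>Toggling the node of the path at the given level flips parity and is its own inverse, so
  one formula serves in both directions. It respects the relations because
  \<open>history g n\<close> is the tail of \<open>history g (Suc n)\<close>.\<close>

lemma path_imp_isomorphic:
  assumes "recursive_in A g" "\<And>n. R n (history g n)"
  shows "computably_isomorphic_in A path_language (path_structure R False) (path_structure R True)"
proof -
  let ?h = "\<lambda>z. prod_encode (pfst z, toggle (psnd z) (history g (pfst z)))"
  let ?U = "\<lambda>b. universe (path_structure R b)"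
  have mem: "?h z \<in> ?U (\<not> b)" if "z \<in> ?U b" for z b
  proof -
    have "R (pfst z) (history g (pfst z)) \<and> (pfst z = 0 \<longrightarrow> history g (pfst z) = 0)"
      using assms(2)[of "pfst z"] by auto
    then show ?thesis
      using that odd_card_sym_diff_singleton[of "set_decode (psnd z)" "history g (pfst z)"]
      by (auto simp: path_structure_def set_decode_toggle)
  qed
  have bij: "bij_betw ?h (?U False) (?U True)"
    by (rule bij_betw_byWitness[where f' = ?h]) (use mem[of _ False] mem[of _ True] in auto)
  have "rel_interp (path_structure R True) k [?h a, ?h b] \<longleftrightarrow>
      rel_interp (path_structure R False) k [a, b]" for k a b
    using push_forward_toggle[of "history g (Suc k)" "psnd a" "psnd b"]
    by (auto simp: path_structure_def)
  then have "structure_isomorphism path_language (path_structure R False) (path_structure R True) ?h"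
    using bij by (auto simp: structure_isomorphism_def path_language_def tuples_2)
  moreover have "recursive_in A ?h"
    by (intro rec_intros recursive_in_history assms)
  ultimately show ?thesis
    unfolding computably_isomorphic_in_def recursive_in_def by blast
qed

text \<open>The image of the empty set at level \<open>n\<close> is a set of nodes at that level, of odd size.  As
  these sets are compatible with taking tails, each of their elements has an extension in the
  next one.\<close>

lemma isomorphic_imp_path:
  assumes "computably_isomorphic_in {} path_language (path_structure R False) (path_structure R True)"
  shows "\<exists>g. recursive_in {} g \<and> (\<forall>n. R n (history g n))"
proof -
  let ?M = "path_structure R False" and ?N = "path_structure R True"
  obtain h f where iso: "structure_isomorphism path_language ?M ?N h" and f: "partial_recursive f"
    and fh: "\<forall>x\<in>universe ?M. f x = Some (h x)"
    using assms unfolding computably_isomorphic_in_def by blast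
  \<comment> \<open>The empty set lies at every level of the even structure, whatever
    \<open>R\<close> is, so its image is computed uniformly in the level.\<close>
  define S where "S n = set_decode (psnd (h (prod_encode (n, 0))))" for n
  have M: "prod_encode (n, 0) \<in> universe ?M" for n
    by (simp add: path_structure_def)
  have "recursive_in {} (\<lambda>n. prod_encode (n, 0))" by (intro rec_intros)
  then have "partial_recursive (\<lambda>n. Option.bind (Some (prod_encode (n, 0))) f)"
    using pr_comp[OF f] unfolding recursive_in_def by blast
  then have h: "recursive_in {} (\<lambda>n. h (prod_encode (n, 0)))"
    using fh M by (simp add: recursive_in_def)
  have S_rec: "recursive_in {} (\<lambda>x. of_bool (p x \<in> S (q x)))"
    if "recursive_in {} p" "recursive_in {} q" for p q
    unfolding S_def by (intro rec_intros that recursive_in_comp[OF h])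
  have N: "h (prod_encode (n, 0)) \<in> universe ?N" for n
    using iso M unfolding structure_isomorphism_def bij_betw_def by blast
  have rel: "\<forall>k. \<forall>xs\<in>tuples (universe ?M) 2. rel_interp ?N k (map h xs) \<longleftrightarrow> rel_interp ?M k xs"
    using iso by (simp add: structure_isomorphism_def path_language_def)
  have "rel_interp ?M n [prod_encode (Suc n, 0), prod_encode (n, 0)]" for n
    by (simp add: path_structure_def push_forward_def)
  then have "rel_interp ?N n (map h [prod_encode (Suc n, 0), prod_encode (n, 0)])" for n
    using rel[rule_format, of "[prod_encode (Suc n, 0), prod_encode (n, 0)]" n] M
    by (simp add: tuples_def)
  then have level: "pfst (h (prod_encode (n, 0))) = n"
    and push: "push_forward (psnd (h (prod_encode (Suc n, 0)))) (psnd (h (prod_encode (n, 0))))" for n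
    by (auto simp: path_structure_def)
  have odd: "odd (card (S n))" and node: "\<sigma> \<in> S n \<Longrightarrow> R n \<sigma> \<and> (n = 0 \<longrightarrow> \<sigma> = 0)" for n \<sigma>
    using N[of n] level[of n] by (auto simp: path_structure_def S_def)
  \<comment> \<open>The guard makes the search succeed for every \<open>s\<close>, so that
    \<open>child\<close> is total.\<close>
  define child where "child n s = (LEAST \<tau>. s \<in> S n \<longrightarrow> \<tau> \<in> S (Suc n) \<and> \<tau> \<noteq> 0 \<and> psnd (\<tau> - 1) = s)" for n s
  have child_ex: "\<exists>\<tau>. s \<in> S n \<longrightarrow> \<tau> \<in> S (Suc n) \<and> \<tau> \<noteq> 0 \<and> psnd (\<tau> - 1) = s" for n s
  proof (cases "s \<in> S n")
    case True
    \<comment> \<open>The coefficient of \<open>s\<close> in the pushed-forward set is 1, so the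
      fibre over \<open>s\<close> has odd size and is not empty.\<close>
    then have "odd (card {\<tau> \<in> S (Suc n). \<tau> \<noteq> 0 \<and> psnd (\<tau> - 1) = s})"
      using push[of n] unfolding push_forward_def S_def by blast
    then show ?thesis using odd_card_imp_ex_mem by blast
  qed simp
  have child: "child n s \<in> S (Suc n) \<and> child n s \<noteq> 0 \<and> psnd (child n s - 1) = s" if "s \<in> S n" for n s
    using LeastI_ex[OF child_ex[of s n]] that unfolding child_def by blast
  define \<sigma> where "\<sigma> = rec_nat 0 child"
  have "recursive_in {} (\<lambda>x. child (pfst x) (psnd x))"
    unfolding child_def
    by (rule recursive_in_Least) (intro rec_intros S_rec child_ex, rule child_ex)
  then have "recursive_in {} \<sigma>"
    unfolding \<sigma>_def using recursive_in_rec_nat[of "{}" "\<lambda>_. 0" "\<lambda>_. child" "\<lambda>x. x"]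
    by (simp add: rec_intros recursive_in_comp2[of "{}" child])
  have "0 \<in> S 0" using odd_card_imp_ex_mem[OF odd[of 0]] node[of _ 0] by blast
  then have mem: "\<sigma> n \<in> S n" for n
    by (induction n) (use child in \<open>auto simp: \<sigma>_def\<close>)
  define g where "g n = pfst (\<sigma> (Suc n) - 1)" for n
  have hist: "history g n = \<sigma> n" for n
  proof (induction n)
    case (Suc n)
    have "0 < \<sigma> (Suc n)" and tl: "psnd (\<sigma> (Suc n) - 1) = \<sigma> n"
      using child[OF mem[of n]] by (auto simp: \<sigma>_def)
    from this(1) have "Suc (prod_encode (pfst (\<sigma> (Suc n) - 1), psnd (\<sigma> (Suc n) - 1))) = \<sigma> (Suc n)"
      by (simp only: prod.collapse prod_decode_inverse Suc_diff_1)
    then show ?case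
      by (simp only: history.simps Suc.IH) (simp only: g_def tl)
  qed (simp add: \<sigma>_def)
  have "recursive_in {} g"
    unfolding g_def by (intro rec_intros recursive_in_comp[OF \<open>recursive_in {} \<sigma>\<close>])
  moreover have "R n (history g n)" for n
    using node[OF mem[of n]] unfolding hist by blast
  ultimately show ?thesis by blast
qed

theorem low_for_isomorphism_imp_low_for_paths:
  assumes "low_for_isomorphism d" "A \<in> d"
    and "recursive_in {} (\<lambda>z. of_bool (R (pfst z) (psnd z)))"
    and "recursive_in A g" "\<And>n. R n (history g n)"
  shows "\<exists>g'. recursive_in {} g' \<and> (\<forall>n. R n (history g' n))"
proof -
  have "computably_isomorphic_in A path_language (path_structure R False) (path_structure R True)"
    using assms(4,5) by (rule path_imp_isomorphic)
  then show ?thesis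
    using assms(1,2) computable_path_language computable_path_structure[OF assms(3)]
      isomorphic_imp_path[of R]
    unfolding low_for_isomorphism_def by blast
qed

section \<open>Arithmetic of codes\<close>

text \<open>Integers are kept as differences of natural numbers, so that all arithmetic stays within
  \<open>nat\<close>. Even codes of \<open>int_decode\<close> are the nonnegative integers; one of
  the two parts always vanishes.\<close>

definition int_pos :: "nat \<Rightarrow> nat" where
  "int_pos a = (if even a then a div 2 else 0)"

definition int_neg :: "nat \<Rightarrow> nat" where
  "int_neg a = (if even a then 0 else Suc (a div 2))"

definition int_code :: "nat \<Rightarrow> nat \<Rightarrow> nat" where
  "int_code x y = (if y \<le> x then 2 * (x - y) else Suc (2 * (y - x - 1)))"

lemma int_decode_eq: "int_decode a = int (int_pos a) - int (int_neg a)"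
  by (simp add: int_decode_def sum_decode_def int_pos_def int_neg_def)

lemma abs_int_decode_eq: "\<bar>int_decode a\<bar> = int (int_pos a + int_neg a)"
  by (simp add: int_decode_eq int_pos_def int_neg_def)

lemma int_decode_int_code: "int_decode (int_code x y) = int x - int y"
  by (auto simp: int_decode_eq int_pos_def int_neg_def int_code_def)

lemma recursive_in_int_codes [rec_intros]:
  assumes "recursive_in A f"
  shows "recursive_in A (\<lambda>x. int_pos (f x))" "recursive_in A (\<lambda>x. int_neg (f x))"
  unfolding int_pos_def int_neg_def by (intro rec_intros assms)+

lemma recursive_in_int_code [rec_intros]:
  assumes "recursive_in A f" "recursive_in A g"
  shows "recursive_in A (\<lambda>x. int_code (f x) (g x))"
  unfolding int_code_def by (intro rec_intros assms)

text \<open>Fractions are cross-multiplied and not reduced; a code stores the denominator minus one,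
  hence the final \<open>- 1\<close>. Subtraction is enough: negation is subtraction from code 0,
  and additivity of the isometry is recovered from differences.\<close>

definition rational_sub :: "nat \<Rightarrow> nat \<Rightarrow> nat" where
  "rational_sub c d = prod_encode
     (int_code (int_pos (pfst c) * Suc (psnd d) + int_neg (pfst d) * Suc (psnd c))
        (int_neg (pfst c) * Suc (psnd d) + int_pos (pfst d) * Suc (psnd c)),
      Suc (psnd c) * Suc (psnd d) - 1)"

lemma recursive_in_rational_sub [rec_intros]:
  assumes "recursive_in A f" "recursive_in A g"
  shows "recursive_in A (\<lambda>x. rational_sub (f x) (g x))"
  unfolding rational_sub_def by (intro rec_intros assms)

lemma rational_of_code_eq:
  "rational_of_code c = (real (int_pos (pfst c)) - real (int_neg (pfst c))) / real (Suc (psnd c))"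
  by (simp add: rational_of_code_def int_decode_eq split: prod.split)

lemma rational_of_code_0 [simp]: "rational_of_code 0 = 0"
  by (simp add: rational_of_code_eq int_pos_def int_neg_def prod_decode_def prod_decode_aux.simps)

lemma rational_of_code_rational_sub:
  "rational_of_code (rational_sub c d) = rational_of_code c - rational_of_code d"
proof -
  have *: "Suc (Suc (psnd c) * Suc (psnd d) - 1) = Suc (psnd c) * Suc (psnd d)" by simp
  have "rational_of_code (rational_sub c d) =
      real_of_int (int_decode (pfst (rational_sub c d))) / (real (Suc (psnd c)) * real (Suc (psnd d)))"
    unfolding rational_of_code_def rational_sub_def
    by (simp only: prod_encode_inverse fst_conv snd_conv split_conv * of_nat_mult)
  also have "real_of_int (int_decode (pfst (rational_sub c d))) =
      (real (int_pos (pfst c)) - real (int_neg (pfst c))) * real (Suc (psnd d)) -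
      (real (int_pos (pfst d)) - real (int_neg (pfst d))) * real (Suc (psnd c))"
    by (simp add: rational_sub_def int_decode_int_code algebra_simps)
  finally show ?thesis
    unfolding rational_of_code_eq by (simp add: divide_simps del: of_nat_Suc)
qed

text \<open>This is \<open>\<bar>q\<bar> \<le> 4 * (1/2) ^ k\<close> with denominators cleared. The
  4 is 3 + 1: the test of differences collects the errors of three approximate values, and a norm is
  known up to one more.\<close>

definition small_code :: "nat \<Rightarrow> nat \<Rightarrow> bool" where
  "small_code c k \<longleftrightarrow> (int_pos (pfst c) + int_neg (pfst c)) * 2 ^ k \<le> 4 * Suc (psnd c)"

lemma recursive_in_small_code [rec_intros]:
  assumes "recursive_in A f" "recursive_in A g"
  shows "recursive_in A (\<lambda>x. of_bool (small_code (f x) (g x)))"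
  unfolding small_code_def by (intro rec_intros assms)

lemma small_code_iff: "small_code c k \<longleftrightarrow> \<bar>rational_of_code c\<bar> \<le> 4 * (1/2) ^ k"
proof -
  have scale: "a / b \<le> 4 * (1/2) ^ k \<longleftrightarrow> a * 2 ^ k \<le> 4 * b" if "b > 0" for a b :: real
    using that by (simp add: power_one_over field_simps)
  have "\<bar>rational_of_code c\<bar> = real_of_int \<bar>int_decode (pfst c)\<bar> / real (Suc (psnd c))"
    by (simp add: rational_of_code_def abs_divide split: prod.split)
  also have "\<dots> = real (int_pos (pfst c) + int_neg (pfst c)) / real (Suc (psnd c))"
    by (simp only: abs_int_decode_eq of_int_of_nat_eq)
  finally have "\<bar>rational_of_code c\<bar> \<le> 4 * (1/2) ^ k \<longleftrightarrow>
      real (int_pos (pfst c) + int_neg (pfst c)) * 2 ^ k \<le> 4 * real (Suc (psnd c))"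
    by (simp only: scale of_nat_0_less_iff zero_less_Suc)
  also have "\<dots> \<longleftrightarrow> real ((int_pos (pfst c) + int_neg (pfst c)) * 2 ^ k) \<le> real (4 * Suc (psnd c))"
    by (simp only: of_nat_mult of_nat_power of_nat_numeral)
  also have "\<dots> \<longleftrightarrow> small_code c k"
    unfolding small_code_def of_nat_le_iff ..
  finally show ?thesis ..
qed

definition small_radius :: "nat \<Rightarrow> nat \<Rightarrow> bool" where
  "small_radius r k \<longleftrightarrow> Suc (pfst r) * 2 ^ k \<le> Suc (psnd r)"

text \<open>This is \<open>q + (1/2) ^ l < r\<close> multiplied by both denominators and
  \<open>2 ^ l\<close>, with the negative part of \<open>q\<close> moved to the right, since
  subtraction on \<open>nat\<close> is truncated. When \<open>q\<close> approximates a norm up to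
  \<open>(1/2) ^ l\<close>, it certifies that the norm is below \<open>r\<close>.\<close>

definition below_radius :: "nat \<Rightarrow> nat \<Rightarrow> nat \<Rightarrow> bool" where
  "below_radius q l r \<longleftrightarrow>
     int_pos (pfst q) * Suc (psnd r) * 2 ^ l + Suc (psnd q) * Suc (psnd r)
     < (int_neg (pfst q) * Suc (psnd r) + Suc (pfst r) * Suc (psnd q)) * 2 ^ l"

lemma recursive_in_small_radius [rec_intros]:
  assumes "recursive_in A f" "recursive_in A g"
  shows "recursive_in A (\<lambda>x. of_bool (small_radius (f x) (g x)))"
  unfolding small_radius_def by (intro rec_intros assms)

lemma recursive_in_below_radius [rec_intros]:
  assumes "recursive_in A f" "recursive_in A g" "recursive_in A h"
  shows "recursive_in A (\<lambda>x. of_bool (below_radius (f x) (g x) (h x)))"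
  unfolding below_radius_def by (intro rec_intros assms)

lemma positive_rational_of_code_eq:
  "positive_rational_of_code r = real (Suc (pfst r)) / real (Suc (psnd r))"
  by (simp add: positive_rational_of_code_def split: prod.split)

lemma small_radius_iff: "small_radius r k \<longleftrightarrow> positive_rational_of_code r \<le> (1/2) ^ k"
proof -
  have "positive_rational_of_code r \<le> (1/2) ^ k \<longleftrightarrow>
      real (Suc (pfst r)) * 2 ^ k \<le> real (Suc (psnd r))"
    unfolding positive_rational_of_code_eq by (simp add: field_simps del: of_nat_Suc)
  also have "\<dots> \<longleftrightarrow> real (Suc (pfst r) * 2 ^ k) \<le> real (Suc (psnd r))"
    by (simp only: of_nat_mult of_nat_power of_nat_numeral)
  also have "\<dots> \<longleftrightarrow> small_radius r k"
    unfolding small_radius_def of_nat_le_iff ..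
  finally show ?thesis ..
qed

lemma below_radius_iff:
  "below_radius q l r \<longleftrightarrow> rational_of_code q + (1/2) ^ l < positive_rational_of_code r"
proof -
  define p n b c e where "p = int_pos (pfst q)" and "n = int_neg (pfst q)" and "b = Suc (psnd q)"
    and "c = Suc (pfst r)" and "e = Suc (psnd r)"
  have pos: "real b > 0" "real e > 0" by (simp_all add: b_def e_def)
  have "rational_of_code q + (1/2) ^ l < positive_rational_of_code r \<longleftrightarrow>
      (real p - real n) / real b + 1 / 2 ^ l < real c / real e"
    by (simp add: rational_of_code_eq positive_rational_of_code_eq p_def n_def b_def c_def e_def
        power_one_over)
  also have "\<dots> \<longleftrightarrow> real p * real e * 2 ^ l + real b * real e
      < (real n * real e + real c * real b) * 2 ^ l"
  proof -
    have "(real p - real n) / real b + 1 / 2 ^ l =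
        ((real p - real n) * real e * 2 ^ l + real b * real e) / (real b * real e * 2 ^ l)"
      using pos by (simp add: field_simps)
    moreover have "real c / real e = (real c * real b * 2 ^ l) / (real b * real e * 2 ^ l)"
      using pos by (simp add: divide_simps)
    moreover have "real b * real e * 2 ^ l > 0" using pos by simp
    ultimately have "(real p - real n) / real b + 1 / 2 ^ l < real c / real e \<longleftrightarrow>
        (real p - real n) * real e * 2 ^ l + real b * real e < real c * real b * 2 ^ l"
      by (metis divide_less_cancel less_asym)
    then show ?thesis by (simp add: algebra_simps)
  qed
  also have "\<dots> \<longleftrightarrow> real (p * e * 2 ^ l + b * e) < real ((n * e + c * b) * 2 ^ l)"
    by (simp only: of_nat_mult of_nat_add of_nat_power of_nat_numeral)
  also have "\<dots> \<longleftrightarrow> below_radius q l r"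
    unfolding below_radius_def of_nat_less_iff p_def n_def b_def c_def e_def ..
  finally show ?thesis ..
qed

text \<open>Heads are dropped by primitive recursion. The value 0 past the end codes the scalar 0,
  so lists of coefficients may be padded.\<close>

definition list_nth :: "nat \<Rightarrow> nat \<Rightarrow> nat" where
  "list_nth n i = (let m = rec_nat n (\<lambda>_ r. if r = 0 then 0 else psnd (r - 1)) i
     in if m = 0 then 0 else pfst (m - 1))"

lemma recursive_in_list_nth [rec_intros]:
  assumes "recursive_in A f" "recursive_in A g"
  shows "recursive_in A (\<lambda>x. list_nth (f x) (g x))"
  unfolding list_nth_def Let_def by (intro rec_intros assms)

lemma list_nth_list_encode: "list_nth (list_encode xs) i = (if i < length xs then xs ! i else 0)"
proof -
  have "rec_nat (list_encode xs) (\<lambda>_ r. if r = 0 then 0 else psnd (r - 1)) i = list_encode (drop i xs)"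
  proof (induction i)
    case (Suc i)
    have "list_encode (tl ys) = (if list_encode ys = 0 then 0 else psnd (list_encode ys - 1))" for ys
      by (cases ys) auto
    from this[of "drop i xs"] show ?case
      by (simp add: Suc.IH drop_Suc tl_drop)
  qed simp
  moreover have "(if list_encode ys = 0 then 0 else pfst (list_encode ys - 1)) =
      (if ys = [] then 0 else hd ys)" for ys
    by (cases ys) auto
  ultimately show ?thesis by (simp add: list_nth_def Let_def hd_drop_conv_nth)
qed

lemma list_nth_eq: "list_nth n i = (if i < length (list_decode n) then list_decode n ! i else 0)"
  using list_nth_list_encode[of "list_decode n" i] by simp

lemma length_le_list_encode: "length xs \<le> list_encode xs"
proof (induction xs)
  case (Cons a xs)
  then show ?case using le_prod_encode_2[of "list_encode xs" a] by simp
qed simp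

lemma length_list_decode_le: "length (list_decode n) \<le> n"
  using length_le_list_encode[of "list_decode n"] by simp

lemma recursive_in_list_encode_map [rec_intros]:
  assumes "recursive_in A (\<lambda>z. f (pfst z) (psnd z))" "recursive_in A h"
  shows "recursive_in A (\<lambda>x. list_encode (map (f x) [0..<h x]))"
proof -
  \<comment> \<open>\<open>list_encode\<close> adds elements in front, so the list is built from its
    last index downwards.\<close>
  have "recursive_in A (\<lambda>x. rec_nat 0 (\<lambda>k r. Suc (prod_encode (f x (h x - Suc k), r))) (h x))"
    by (intro rec_intros assms recursive_in_comp2[OF assms(1)] recursive_in_comp[OF assms(2)])
  moreover have "rec_nat 0 (\<lambda>k r. Suc (prod_encode (F (N - Suc k), r))) k =
      list_encode (map F [N - k..<N])" if "k \<le> N" for F N k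
    using that
  proof (induction k)
    case (Suc k)
    then have "[N - Suc k..<N] = (N - Suc k) # [N - k..<N]"
      by (simp add: upt_conv_Cons Suc_diff_Suc)
    then show ?case using Suc by simp
  qed simp
  ultimately show ?thesis by simp
qed

section \<open>Rational points\<close>

definition scalar_sub :: "complex set \<Rightarrow> nat \<Rightarrow> nat \<Rightarrow> nat" where
  "scalar_sub F c d = (if F = \<real> then rational_sub c d
     else prod_encode (rational_sub (pfst c) (pfst d), rational_sub (psnd c) (psnd d)))"

definition scalar_rotate :: "complex set \<Rightarrow> nat \<Rightarrow> nat" where
  "scalar_rotate F c = (if F = \<real> then c else prod_encode (rational_sub 0 (psnd c), pfst c))"

text \<open>Together with the real scalars, this number generates the scalar field.\<close>

definition unit_of :: "complex set \<Rightarrow> complex" where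
  "unit_of F = (if F = \<real> then 1 else \<i>)"

text \<open>A code bounds the length of the list it codes, so \<open>m + n\<close> is a common
  length that needs no measuring; the surplus coefficients are zero by the default of
  \<open>list_nth\<close>.\<close>

definition point_sub :: "complex set \<Rightarrow> nat \<Rightarrow> nat \<Rightarrow> nat" where
  "point_sub F m n = list_encode (map (\<lambda>i. scalar_sub F (list_nth m i) (list_nth n i)) [0..<m + n])"

definition point_rotate :: "complex set \<Rightarrow> nat \<Rightarrow> nat" where
  "point_rotate F m = list_encode (map (\<lambda>i. scalar_rotate F (list_nth m i)) [0..<m])"

lemma recursive_in_point_sub [rec_intros]:
  assumes "recursive_in A f" "recursive_in A g"
  shows "recursive_in A (\<lambda>x. point_sub F (f x) (g x))"
  by (rule recursive_in_comp2[OF _ assms]) (unfold point_sub_def scalar_sub_def, intro rec_intros)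

lemma recursive_in_point_rotate [rec_intros]:
  assumes "recursive_in A f"
  shows "recursive_in A (\<lambda>x. point_rotate F (f x))"
  by (rule recursive_in_comp[OF _ assms]) (unfold point_rotate_def scalar_rotate_def, intro rec_intros)

lemma scalar_of_code_0 [simp]: "scalar_of_code F 0 = 0"
  by (simp add: scalar_of_code_def prod_decode_def prod_decode_aux.simps zero_complex.code)

lemma scalar_of_code_scalar_sub:
  "scalar_of_code F (scalar_sub F c d) = scalar_of_code F c - scalar_of_code F d"
  by (simp add: scalar_of_code_def scalar_sub_def rational_of_code_rational_sub complex_eq_iff
      split: prod.split)

lemma scalar_of_code_scalar_rotate:
  "scalar_of_code F (scalar_rotate F c) = unit_of F * scalar_of_code F c"
  by (simp add: scalar_of_code_def scalar_rotate_def unit_of_def rational_of_code_rational_sub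
      complex_eq_iff split: prod.split)

context
  fixes F :: "complex set" and s :: "complex \<Rightarrow> 'a::banach \<Rightarrow> 'a"
  assumes banach: "banach_space_over F s"
begin

lemma field_cases: "F = \<real> \<or> F = UNIV"
  using banach by (auto simp: banach_space_over_def)

lemma scale_of_real: "s (complex_of_real r) x = r *\<^sub>R x"
  using banach by (auto simp: banach_space_over_def)

lemma scale_0_left [simp]: "s 0 x = 0"
  using scale_of_real[of 0 x] by simp

text \<open>For \<open>F = \<real>\<close> nothing is known about \<open>s\<close> at nonreal
  numbers. The laws below are therefore restricted to scalars in \<open>F\<close> and proved once
  from \<open>scaleR\<close> and once from \<open>vector_space\<close>.\<close>

lemma complex_cases:
  obtains (real) "F = \<real>"
  | (complex) "F = UNIV" "F \<noteq> \<real>" "vector_space s" "\<And>c x. norm (s c x) = cmod c * norm x"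
proof (cases "F = \<real>")
  case False
  then show ?thesis using banach that by (auto simp: banach_space_over_def)
qed (rule that(1))

lemma scalar_of_code_mem: "scalar_of_code F n \<in> F"
  using range_scalar_of_code[OF field_cases] by (auto simp: rational_scalars_def)

lemma unit_of_mem: "unit_of F \<in> F"
  using field_cases by (auto simp: unit_of_def)

lemma scale_diff_left: "c \<in> F \<Longrightarrow> d \<in> F \<Longrightarrow> s (c - d) x = s c x - s d x"
proof (cases rule: complex_cases)
  case real
  then show "c \<in> F \<Longrightarrow> d \<in> F \<Longrightarrow> ?thesis"
    by (auto elim!: Reals_cases simp flip: of_real_diff simp: scale_of_real scaleR_diff_left)
next
  case complex
  interpret vector_space s by (rule complex(3))
  show ?thesis by (simp add: scale_left_diff_distrib)
qed

lemma scale_diff_right: "c \<in> F \<Longrightarrow> s c (x - y) = s c x - s c y"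
proof (cases rule: complex_cases)
  case real
  then show "c \<in> F \<Longrightarrow> ?thesis"
    by (auto elim!: Reals_cases simp: scale_of_real scaleR_diff_right)
next
  case complex
  interpret vector_space s by (rule complex(3))
  show ?thesis by (simp add: scale_right_diff_distrib)
qed

lemma scale_add_right: "c \<in> F \<Longrightarrow> s c (x + y) = s c x + s c y"
proof (cases rule: complex_cases)
  case real
  then show "c \<in> F \<Longrightarrow> ?thesis"
    by (auto elim!: Reals_cases simp: scale_of_real scaleR_add_right)
next
  case complex
  interpret vector_space s by (rule complex(3))
  show ?thesis by (simp add: scale_right_distrib)
qed

lemma scale_mult: "c \<in> F \<Longrightarrow> d \<in> F \<Longrightarrow> s (c * d) x = s c (s d x)"
proof (cases rule: complex_cases)
  case real
  then show "c \<in> F \<Longrightarrow> d \<in> F \<Longrightarrow> ?thesis"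
    by (auto elim!: Reals_cases simp flip: of_real_mult simp: scale_of_real)
next
  case complex
  interpret vector_space s by (rule complex(3))
  show ?thesis by (simp add: scale_scale)
qed

lemma norm_scale: "c \<in> F \<Longrightarrow> norm (s c x) = cmod c * norm x"
proof (cases rule: complex_cases)
  case real
  then show "c \<in> F \<Longrightarrow> ?thesis"
    by (auto elim!: Reals_cases simp: scale_of_real)
qed simp

lemma scale_sum_right: "c \<in> F \<Longrightarrow> s c (sum f {..<n::nat}) = (\<Sum>i<n. s c (f i))"
proof (induction n)
  case 0
  then show ?case using norm_scale[of c 0] by simp
qed (simp add: scale_add_right)

lemma rational_point_eq:
  assumes "m \<le> n"
  shows "rational_point F s v m = (\<Sum>i<n. s (scalar_of_code F (list_nth m i)) (v i))"
  unfolding rational_point_def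
  by (rule sum.mono_neutral_cong_left)
    (use assms length_list_decode_le[of m] in \<open>auto simp: list_nth_eq\<close>)

lemma rational_point_point_sub:
  "rational_point F s v (point_sub F m n) = rational_point F s v m - rational_point F s v n"
  unfolding rational_point_eq[of m "m + n", simplified] rational_point_eq[of n "m + n", simplified]
  by (simp add: rational_point_def point_sub_def scalar_of_code_scalar_sub scalar_of_code_mem
      scale_diff_left sum_subtractf)

lemma rational_point_point_rotate:
  "rational_point F s v (point_rotate F m) = s (unit_of F) (rational_point F s v m)"
  unfolding rational_point_eq[of m m, simplified]
  by (simp add: rational_point_def point_rotate_def scalar_of_code_scalar_rotate scalar_of_code_mem
      unit_of_mem scale_mult scale_sum_right)

lemma rational_scalars_dense:
  assumes "c \<in> F"
  shows "\<exists>q. (\<forall>n. q n \<in> rational_scalars F) \<and> q \<longlonglongrightarrow> c"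
proof -
  have "\<exists>q. (\<forall>n. q n \<in> \<rat>) \<and> q \<longlonglongrightarrow> r" for r :: real
    using Rats_closure_real[unfolded set_eq_iff closure_sequential] by blast
  then obtain a b where a: "\<And>n. a n \<in> \<rat>" "a \<longlonglongrightarrow> Re c" and b: "\<And>n. b n \<in> \<rat>" "b \<longlonglongrightarrow> Im c"
    by metis
  show ?thesis
  proof (cases "F = \<real>")
    case True
    have "(\<lambda>n. complex_of_real (a n)) \<longlonglongrightarrow> complex_of_real (Re c)"
      using a(2) by (rule tendsto_of_real)
    moreover have "complex_of_real (Re c) = c"
      using assms True by (auto elim: Reals_cases)
    moreover have "complex_of_real (a n) \<in> rational_scalars F" for n
      using a(1)[of n] True
      by (auto simp: rational_scalars_def complex_of_real_def complex_is_Real_iff)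
    ultimately show ?thesis by (intro exI[of _ "\<lambda>n. complex_of_real (a n)"]) simp
  next
    case False
    then have "F = UNIV" using field_cases by auto
    moreover have "(\<lambda>n. Complex (a n) (b n)) \<longlonglongrightarrow> Complex (Re c) (Im c)"
      by (intro tendsto_Complex a b)
    ultimately show ?thesis
      using a(1) b(1) by (intro exI[of _ "\<lambda>n. Complex (a n) (b n)"]) (auto simp: rational_scalars_def)
  qed
qed

text \<open>A presentation only promises density of the combinations with coefficients in
  \<open>F\<close>. Each combination has finitely many coefficients; approximating them by rational
  scalars approximates the combination, by homogeneity of the norm.\<close>

lemma closure_range_rational_point:
  assumes "is_presentation F s v"
  shows "closure (range (rational_point F s v)) = UNIV"
proof -
  have "linear_combinations F s v \<subseteq> closure (range (rational_point F s v))"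
  proof
    fix x assume "x \<in> linear_combinations F s v"
    then obtain n c where c: "\<forall>i<n. c i \<in> F" and x: "x = (\<Sum>i<n. s (c i) (v i))"
      unfolding linear_combinations_def by blast
    have "\<forall>i<n. \<exists>q. (\<forall>j. q j \<in> rational_scalars F) \<and> q \<longlonglongrightarrow> c i"
      using rational_scalars_dense c by blast
    then obtain q where q: "\<And>i j. i < n \<Longrightarrow> q i j \<in> rational_scalars F" "\<And>i. i < n \<Longrightarrow> q i \<longlonglongrightarrow> c i"
      by metis
    have "(\<lambda>j. s (q i j) (v i)) \<longlonglongrightarrow> s (c i) (v i)" if "i < n" for i
    proof -
      have "s (q i j) (v i) - s (c i) (v i) = s (q i j - c i) (v i)" "q i j - c i \<in> F" for j
      proof -
        have "q i j \<in> F" "c i \<in> F"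
          using q(1)[OF that] c that by (auto simp: rational_scalars_def)
        then show "s (q i j) (v i) - s (c i) (v i) = s (q i j - c i) (v i)" "q i j - c i \<in> F"
          using field_cases by (auto simp: scale_diff_left)
      qed
      then have "dist (s (q i j) (v i)) (s (c i) (v i)) = dist (q i j) (c i) * norm (v i)" for j
        by (simp add: dist_norm norm_scale)
      moreover have "(\<lambda>j. dist (q i j) (c i) * norm (v i)) \<longlonglongrightarrow> 0 * norm (v i)"
        using q(2)[OF that] by (intro tendsto_mult tendsto_const) (simp flip: tendsto_dist_iff)
      ultimately show ?thesis unfolding tendsto_dist_iff[of _ "s (c i) (v i)"] by simp
    qed
    then have "(\<lambda>j. \<Sum>i<n. s (q i j) (v i)) \<longlonglongrightarrow> x"
      unfolding x by (intro tendsto_sum) simp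
    moreover have "(\<Sum>i<n. s (q i j) (v i)) \<in> range (rational_point F s v)" for j
      unfolding range_rational_point[OF field_cases] linear_combinations_def mem_Collect_eq
      using q(1) by (intro exI[of _ n] exI[of _ "\<lambda>i. q i j"]) simp
    ultimately show "x \<in> closure (range (rational_point F s v))"
      unfolding closure_sequential by (intro exI[of _ "\<lambda>j. \<Sum>i<n. s (q i j) (v i)"]) simp
  qed
  then have "closure (linear_combinations F s v) \<subseteq> closure (range (rational_point F s v))"
    by (simp add: closure_minimal)
  then show ?thesis using assms by (auto simp: is_presentation_def)
qed

lemma rational_point_near:
  assumes "is_presentation F s v" "e > 0"
  shows "\<exists>m. dist (rational_point F s v m) x < e"
  using closure_range_rational_point[OF assms(1)] assms(2)
  by (auto simp: set_eq_iff closure_approachable)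

end

section \<open>Isometric isomorphisms from values at rational points\<close>

text \<open>Cauchy's functional equation: additivity yields natural, integer and rational factors,
  and continuity passes from the rationals to the reals.\<close>

lemma additive_continuous_scaleR:
  fixes f :: "'a::real_normed_vector \<Rightarrow> 'b::real_normed_vector"
  assumes add: "\<And>x y. f (x + y) = f x + f y" and cont: "\<And>x. isCont f x"
  shows "f (r *\<^sub>R x) = r *\<^sub>R f x"
proof -
  interpret additive f by standard (rule add)
  have nat: "f (real n *\<^sub>R x) = real n *\<^sub>R f x" for n x
    by (induction n) (simp_all add: zero add scaleR_left_distrib)
  have int: "f (real_of_int i *\<^sub>R x) = real_of_int i *\<^sub>R f x" for i x
    by (cases i rule: int_cases2) (simp_all add: nat minus)
  have rat: "f (q *\<^sub>R x) = q *\<^sub>R f x" if "q \<in> \<rat>" for q x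
  proof -
    from that obtain a b where b: "b > 0" and q: "q = of_int a / of_int b"
      by (metis Rats_cases')
    have "real_of_int b *\<^sub>R f (q *\<^sub>R x) = real_of_int a *\<^sub>R f x"
      using b by (simp add: q flip: int)
    then have "(1 / real_of_int b) *\<^sub>R (real_of_int b *\<^sub>R f (q *\<^sub>R x)) =
        (1 / real_of_int b) *\<^sub>R (real_of_int a *\<^sub>R f x)" by (rule arg_cong)
    then show ?thesis using b by (simp add: q)
  qed
  obtain q where q: "\<And>n. q n \<in> \<rat>" "q \<longlonglongrightarrow> r"
    using Rats_closure_real[unfolded set_eq_iff closure_sequential] by blast
  have "(\<lambda>n. q n *\<^sub>R x) \<longlonglongrightarrow> r *\<^sub>R x" by (intro tendsto_intros q)
  then have "(\<lambda>n. f (q n *\<^sub>R x)) \<longlonglongrightarrow> f (r *\<^sub>R x)"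
    using cont by (rule isCont_tendsto_compose[rotated])
  moreover have "(\<lambda>n. q n *\<^sub>R f x) \<longlonglongrightarrow> r *\<^sub>R f x" by (intro tendsto_intros q)
  ultimately show ?thesis using q(1) by (simp add: rat) (metis LIMSEQ_unique)
qed

context
  fixes F :: "complex set" and s :: "complex \<Rightarrow> 'a::banach \<Rightarrow> 'a"
  assumes banach: "banach_space_over F s"
begin

lemma dist_scale: "c \<in> F \<Longrightarrow> dist (s c x) (s c y) = cmod c * dist x y"
  by (simp add: dist_norm norm_scale[OF banach] flip: scale_diff_right[OF banach])

lemma tendsto_scale: "c \<in> F \<Longrightarrow> X \<longlonglongrightarrow> x \<Longrightarrow> (\<lambda>n. s c (X n)) \<longlonglongrightarrow> s c x"
  unfolding tendsto_dist_iff[of _ "s c x"] tendsto_dist_iff[of _ x]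
  by (auto simp: dist_scale intro: tendsto_mult_right_zero)

text \<open>Differences give additivity, continuity adds the real factors, and over the complex
  numbers these together with \<open>\<i>\<close> give all scalars. The isometric image of a
  complete space is complete, hence closed, so a dense range is everything.\<close>

lemma isometric_isomorphismI:
  assumes dist: "\<And>x y. dist (\<Psi> x) (\<Psi> y) = dist x y" and sub: "\<And>x y. \<Psi> (x - y) = \<Psi> x - \<Psi> y"
    and rotate: "\<And>x. \<Psi> (s (unit_of F) x) = s (unit_of F) (\<Psi> x)"
    and dense: "closure (range \<Psi>) = UNIV"
  shows "isometric_isomorphism F s s \<Psi>"
proof -
  have "\<Psi> 0 = 0" using sub[of 0 0] by simp
  then have "\<Psi> (- y) = - \<Psi> y" for y using sub[of 0 y] by simp
  then have add: "\<Psi> (x + y) = \<Psi> x + \<Psi> y" for x y using sub[of x "- y"] by simp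
  have "isCont \<Psi> x" for x
    unfolding continuous_at_eps_delta by (metis dist)
  then have scaleR: "\<Psi> (r *\<^sub>R x) = r *\<^sub>R \<Psi> x" for r x
    using add by (rule additive_continuous_scaleR[rotated])
  have scale: "\<Psi> (s c x) = s c (\<Psi> x)" if "c \<in> F" for c x
  proof (cases rule: complex_cases[OF banach])
    case 1
    then show ?thesis using that by (auto elim!: Reals_cases simp: scale_of_real[OF banach] scaleR)
  next
    case 2
    interpret vector_space s by (rule 2(3))
    have c: "c = complex_of_real (Re c) + complex_of_real (Im c) * \<i>"
      by (simp add: complex_eq_iff)
    have "s c y = Re c *\<^sub>R y + Im c *\<^sub>R s \<i> y" for y
      by (subst c) (simp only: scale_left_distrib scale_scale[symmetric] scale_of_real[OF banach])
    then show ?thesis using 2(2) rotate by (simp add: add scaleR unit_of_def)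
  qed
  have "complete (range \<Psi>)"
  proof (rule completeI)
    fix X assume X: "\<forall>n. X n \<in> range \<Psi>" "Cauchy X"
    then have "\<forall>n. \<exists>y. X n = \<Psi> y" by blast
    then obtain Y where Y: "\<And>n. X n = \<Psi> (Y n)" by metis
    have "Cauchy Y" using X(2) unfolding Cauchy_def Y dist .
    then obtain y where "Y \<longlonglongrightarrow> y" using Cauchy_convergent convergent_def by blast
    then have "X \<longlonglongrightarrow> \<Psi> y"
      by (simp add: tendsto_dist_iff[of X] tendsto_dist_iff[of Y] Y dist)
    then show "\<exists>l\<in>range \<Psi>. X \<longlonglongrightarrow> l" by blast
  qed
  then have "closed (range \<Psi>)" by (rule complete_imp_closed)
  then have "surj \<Psi>" using dense by (simp add: closure_closed)
  moreover have "inj \<Psi>" by (rule injI) (metis dist dist_eq_0_iff)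
  ultimately show ?thesis
    using add scale dist by (auto simp: isometric_isomorphism_def bij_def)
qed

text \<open>Different indices may name the same point. Norms of differences agree, hence distances
  do, so \<open>\<phi> m\<close> depends on \<open>p m\<close> alone; the induced map is uniformly
  continuous and extends to the closure. The identities pass to limits.\<close>

lemma isometric_extension:
  assumes dense: "closure (range p) = UNIV" and dense': "closure (range \<phi>) = UNIV"
    and p_sub: "\<And>m n. p (sub m n) = p m - p n" and \<phi>_sub: "\<And>m n. \<phi> (sub m n) = \<phi> m - \<phi> n"
    and p_rotate: "\<And>m. p (rot m) = s (unit_of F) (p m)"
    and \<phi>_rotate: "\<And>m. \<phi> (rot m) = s (unit_of F) (\<phi> m)"
    and norm: "\<And>m. norm (\<phi> m) = norm (p m)"
  shows "\<exists>\<Psi>. isometric_isomorphism F s s \<Psi> \<and> (\<forall>m. \<Psi> (p m) = \<phi> m)"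
proof -
  have dist_\<phi>: "dist (\<phi> m) (\<phi> n) = dist (p m) (p n)" for m n
    unfolding dist_norm by (metis \<phi>_sub p_sub norm)
  define f where "f x = \<phi> (SOME m. p m = x)" for x
  have f: "f (p m) = \<phi> m" for m
  proof -
    have "p (SOME n. p n = p m) = p m" by (rule someI[of _ m]) simp
    then show ?thesis using dist_\<phi>[of "SOME n. p n = p m" m] by (simp add: f_def)
  qed
  have "uniformly_continuous_on (range p) f"
    unfolding uniformly_continuous_on_def by (auto simp: f dist_\<phi>)
  then obtain \<Psi> where "uniformly_continuous_on (closure (range p)) \<Psi>"
    and \<Psi>f: "\<And>x. x \<in> range p \<Longrightarrow> f x = \<Psi> x"
    by (rule uniformly_continuous_on_extension_on_closure) blast
  then have "continuous_on UNIV \<Psi>"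
    unfolding dense by (intro uniformly_continuous_imp_continuous)
  then have cont: "isCont \<Psi> x" for x
    by (simp add: continuous_on_eq_continuous_at)
  have \<Psi>: "\<Psi> (p m) = \<phi> m" for m
    using \<Psi>f[of "p m"] by (simp add: f)
  have "\<exists>X. (\<lambda>n. p (X n)) \<longlonglongrightarrow> x" for x
  proof -
    have "x \<in> closure (range p)" using dense by simp
    then obtain Y where Y: "\<And>n. Y n \<in> range p" "Y \<longlonglongrightarrow> x" unfolding closure_sequential by blast
    then have "\<forall>n. \<exists>m. Y n = p m" by blast
    then obtain X where "Y = (\<lambda>n. p (X n))" by metis
    then show ?thesis using Y(2) by blast
  qed
  then obtain X where X: "\<And>x. (\<lambda>n. p (X x n)) \<longlonglongrightarrow> x" by metis
  have \<Psi>X: "(\<lambda>n. \<phi> (X x n)) \<longlonglongrightarrow> \<Psi> x" for x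
    using isCont_tendsto_compose[OF cont X] by (simp add: \<Psi>)
  have "isometric_isomorphism F s s \<Psi>"
  proof (rule isometric_isomorphismI)
    show "dist (\<Psi> x) (\<Psi> y) = dist x y" for x y
      using tendsto_dist[OF X[of x] X[of y]] tendsto_dist[OF \<Psi>X[of x] \<Psi>X[of y]]
      unfolding dist_\<phi> using LIMSEQ_unique by blast
    show "\<Psi> (x - y) = \<Psi> x - \<Psi> y" for x y
    proof -
      have "(\<lambda>n. \<Psi> (p (X x n) - p (X y n))) \<longlonglongrightarrow> \<Psi> (x - y)"
        by (intro isCont_tendsto_compose[OF cont] tendsto_diff X)
      moreover have "(\<lambda>n. \<phi> (X x n) - \<phi> (X y n)) \<longlonglongrightarrow> \<Psi> x - \<Psi> y"
        by (intro tendsto_diff \<Psi>X)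
      moreover have "\<Psi> (p (X x n) - p (X y n)) = \<phi> (X x n) - \<phi> (X y n)" for n
        by (simp flip: p_sub \<phi>_sub add: \<Psi>)
      ultimately show ?thesis by (simp add: LIMSEQ_unique)
    qed
    show "\<Psi> (s (unit_of F) x) = s (unit_of F) (\<Psi> x)" for x
    proof -
      have "(\<lambda>n. \<Psi> (s (unit_of F) (p (X x n)))) \<longlonglongrightarrow> \<Psi> (s (unit_of F) x)"
        by (intro isCont_tendsto_compose[OF cont] tendsto_scale unit_of_mem[OF banach] X)
      moreover have "(\<lambda>n. s (unit_of F) (\<phi> (X x n))) \<longlonglongrightarrow> s (unit_of F) (\<Psi> x)"
        by (intro tendsto_scale unit_of_mem[OF banach] \<Psi>X)
      moreover have "\<Psi> (s (unit_of F) (p (X x n))) = s (unit_of F) (\<phi> (X x n))" for n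
        by (simp flip: p_rotate \<phi>_rotate add: \<Psi>)
      ultimately show ?thesis by (simp add: LIMSEQ_unique)
    qed
    have "range \<phi> \<subseteq> range \<Psi>" using \<Psi> by (metis image_subsetI rangeI)
    then show "closure (range \<Psi>) = UNIV" using dense' closure_mono by blast
  qed
  then show ?thesis using \<Psi> by blast
qed

end

section \<open>Isometric isomorphisms as paths\<close>

text \<open>Entry \<open>prod_encode (m, k)\<close> of a path codes a pair: a rational point within \<open>2 ^ - k\<close>, up to
  a constant factor, of the image of the rational point \<open>m\<close>, and a rational point whose image is
  that close to the rational point \<open>m\<close> of the codomain.  All comparisons are between
  approximations of norms, so that they are decidable.\<close>

definition isometry_test ::
  "complex set \<Rightarrow> (nat \<Rightarrow> nat \<Rightarrow> nat) \<Rightarrow> (nat \<Rightarrow> nat \<Rightarrow> nat) \<Rightarrow> (nat \<Rightarrow> nat) \<Rightarrow>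
     nat \<Rightarrow> nat \<Rightarrow> nat \<Rightarrow> nat \<Rightarrow> bool" where
  "isometry_test F \<mu> \<nu> g m n k j \<longleftrightarrow>
     small_code (rational_sub (\<mu> (pfst (g (prod_encode (m, k)))) k) (\<nu> m k)) k \<and>
     small_code (\<mu> (point_sub F (pfst (g (prod_encode (m, k)))) (pfst (g (prod_encode (m, k + j))))) k) k \<and>
     small_code (\<mu> (point_sub F (pfst (g (prod_encode (point_sub F m n, k))))
       (point_sub F (pfst (g (prod_encode (m, k)))) (pfst (g (prod_encode (n, k)))))) k) k \<and>
     small_code (\<mu> (point_sub F (pfst (g (prod_encode (point_rotate F m, k))))
       (point_rotate F (pfst (g (prod_encode (m, k)))))) k) k \<and>
     small_code (\<mu> (point_sub F m
       (pfst (g (prod_encode (psnd (g (prod_encode (m, k))), k))))) k) k"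

text \<open>A history of length \<open>l\<close> knows only the entries below \<open>l\<close>, and
  these are the entries that the test reads. One index is itself taken from an entry of
  \<open>g\<close>, so the length required is not a function of the parameters alone.\<close>

definition queries_below ::
  "complex set \<Rightarrow> (nat \<Rightarrow> nat) \<Rightarrow> nat \<Rightarrow> nat \<Rightarrow> nat \<Rightarrow> nat \<Rightarrow> nat \<Rightarrow> bool" where
  "queries_below F g m n k j l \<longleftrightarrow>
     prod_encode (m, k) < l \<and> prod_encode (m, k + j) < l \<and> prod_encode (n, k) < l \<and>
     prod_encode (point_sub F m n, k) < l \<and> prod_encode (point_rotate F m, k) < l \<and>
     prod_encode (psnd (g (prod_encode (m, k))), k) < l"

text \<open>A level checks the single tuple of parameters coded in \<open>pfst l\<close> and lets
  the node pass if it is too short. As \<open>psnd l\<close> is free, every tuple recurs at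
  arbitrarily high levels and is finally checked. Histories have the latest entry in front, hence
  the index \<open>l - Suc i\<close>.\<close>

definition isometry_node ::
  "complex set \<Rightarrow> (nat \<Rightarrow> nat \<Rightarrow> nat) \<Rightarrow> (nat \<Rightarrow> nat \<Rightarrow> nat) \<Rightarrow> nat \<Rightarrow> nat \<Rightarrow> bool" where
  "isometry_node F \<mu> \<nu> l \<sigma> \<longleftrightarrow>
     (let e = pfst l; m = pfst (pfst e); n = psnd (pfst e); k = pfst (psnd e); j = psnd (psnd e);
        g = (\<lambda>i. list_nth \<sigma> (l - Suc i))
      in queries_below F g m n k j l \<longrightarrow> isometry_test F \<mu> \<nu> g m n k j)"

lemma history_eq: "history g n = list_encode (rev (map g [0..<n]))"
  by (induction n) auto

lemma list_nth_history: "i < l \<Longrightarrow> list_nth (history g l) (l - Suc i) = g i"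
  by (simp add: history_eq list_nth_list_encode rev_nth)

lemma recursive_in_isometry_node:
  assumes "recursive_in A (\<lambda>z. \<mu> (pfst z) (psnd z))" "recursive_in A (\<lambda>z. \<nu> (pfst z) (psnd z))"
  shows "recursive_in A (\<lambda>z. of_bool (isometry_node F \<mu> \<nu> (pfst z) (psnd z)))"
  unfolding isometry_node_def isometry_test_def queries_below_def Let_def
  by (intro rec_intros recursive_in_comp2[OF assms(1)] recursive_in_comp2[OF assms(2)])

lemma isometry_node_history:
  "(\<forall>l. isometry_node F \<mu> \<nu> l (history g l)) \<longleftrightarrow> (\<forall>m n k j. isometry_test F \<mu> \<nu> g m n k j)"
proof -
  have eq: "queries_below F (\<lambda>i. list_nth (history g l) (l - Suc i)) m n k j l \<and>
        isometry_test F \<mu> \<nu> (\<lambda>i. list_nth (history g l) (l - Suc i)) m n k j \<longleftrightarrow>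
      queries_below F g m n k j l \<and> isometry_test F \<mu> \<nu> g m n k j"
    "queries_below F (\<lambda>i. list_nth (history g l) (l - Suc i)) m n k j l \<longleftrightarrow>
      queries_below F g m n k j l" for m n k j l
    by (auto simp: queries_below_def isometry_test_def list_nth_history)
  have "isometry_test F \<mu> \<nu> g m n k j" if node: "\<forall>l. isometry_node F \<mu> \<nu> l (history g l)" for m n k j
  proof -
    define b where "b = Suc (prod_encode (m, k) + prod_encode (m, k + j) + prod_encode (n, k) +
      prod_encode (point_sub F m n, k) + prod_encode (point_rotate F m, k) +
      prod_encode (psnd (g (prod_encode (m, k))), k))"
    define l where
      "l = prod_encode (prod_encode (prod_encode (m, n), prod_encode (k, j)), b)"
    have "b \<le> l" unfolding l_def by (rule le_prod_encode_2)
    then have "queries_below F g m n k j l"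
      unfolding queries_below_def by (auto simp: b_def)
    then show ?thesis
      using node[rule_format, of l] eq[where m = m and n = n and k = k and j = j and l = l]
      by (simp add: isometry_node_def Let_def l_def)
  qed
  moreover have "isometry_node F \<mu> \<nu> l (history g l)"
    if "\<forall>m n k j. isometry_test F \<mu> \<nu> g m n k j" for l
    unfolding isometry_node_def Let_def using that eq by blast
  ultimately show ?thesis by blast
qed

section \<open>Approximate norms and the margins of the tests\<close>

definition approximates_norms ::
  "complex set \<Rightarrow> (complex \<Rightarrow> 'a::banach \<Rightarrow> 'a) \<Rightarrow> (nat \<Rightarrow> 'a) \<Rightarrow> (nat \<Rightarrow> nat \<Rightarrow> nat) \<Rightarrow> bool" where
  "approximates_norms F s v \<mu> \<longleftrightarrow>
     (\<forall>n k. \<bar>rational_of_code (\<mu> n k) - norm (rational_point F s v n)\<bar> < (1/2) ^ k)"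

lemma computable_presentation_norms:
  assumes "computable_presentation F s v"
  shows "\<exists>\<mu>. recursive_in {} (\<lambda>z. \<mu> (pfst z) (psnd z)) \<and> approximates_norms F s v \<mu>"
proof -
  obtain f where f: "partial_recursive f"
    and q: "\<And>n k. \<exists>q. f (prod_encode (n, k)) = Some q \<and>
      \<bar>rational_of_code q - norm (rational_point F s v n)\<bar> < (1/2) ^ k"
    using assms unfolding computable_presentation_def by blast
  define \<mu> where "\<mu> n k = the (f (prod_encode (n, k)))" for n k
  have \<mu>: "f (prod_encode (n, k)) = Some (\<mu> n k)"
    "\<bar>rational_of_code (\<mu> n k) - norm (rational_point F s v n)\<bar> < (1/2) ^ k" for n k
    using q[of n k] by (auto simp: \<mu>_def)
  have "f z = Some (\<mu> (pfst z) (psnd z))" for z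
    using \<mu>(1)[of "pfst z" "psnd z"] by simp
  then have "f = (\<lambda>z. Some (\<mu> (pfst z) (psnd z)))" by blast
  then show ?thesis
    using f \<mu>(2) unfolding recursive_in_def approximates_norms_def by blast
qed

text \<open>The approximation error 1 is added to or taken from the threshold 4 of
  \<open>small_code\<close>, in units of \<open>(1/2) ^ k\<close>, which leaves the margins 5 and
  3.\<close>

lemma approximates_normsD:
  assumes "approximates_norms F s v \<mu>"
  shows "small_code (\<mu> n k) k \<Longrightarrow> norm (rational_point F s v n) \<le> 5 * (1/2) ^ k"
    and "norm (rational_point F s v n) \<le> 3 * (1/2) ^ k \<Longrightarrow> small_code (\<mu> n k) k"
proof -
  have *: "\<bar>rational_of_code (\<mu> n k) - norm (rational_point F s v n)\<bar> < (1/2) ^ k"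
    using assms by (simp add: approximates_norms_def)
  show "small_code (\<mu> n k) k \<Longrightarrow> norm (rational_point F s v n) \<le> 5 * (1/2) ^ k"
    using * unfolding small_code_iff by linarith
  show "norm (rational_point F s v n) \<le> 3 * (1/2) ^ k \<Longrightarrow> small_code (\<mu> n k) k"
    using * norm_ge_zero[of "rational_point F s v n"] unfolding small_code_iff by linarith
qed

lemma approximates_norms_small_diff:
  assumes "approximates_norms F s v \<mu>" "approximates_norms F s w \<nu>"
  shows "small_code (rational_sub (\<mu> m k) (\<nu> n k)) k \<Longrightarrow>
      \<bar>norm (rational_point F s v m) - norm (rational_point F s w n)\<bar> \<le> 6 * (1/2) ^ k"
    and "\<bar>norm (rational_point F s v m) - norm (rational_point F s w n)\<bar> \<le> 2 * (1/2) ^ k \<Longrightarrow>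
      small_code (rational_sub (\<mu> m k) (\<nu> n k)) k"
proof -
  have *: "\<bar>rational_of_code (\<mu> m k) - norm (rational_point F s v m)\<bar> < (1/2) ^ k"
    "\<bar>rational_of_code (\<nu> n k) - norm (rational_point F s w n)\<bar> < (1/2) ^ k"
    using assms by (simp_all add: approximates_norms_def)
  show "small_code (rational_sub (\<mu> m k) (\<nu> n k)) k \<Longrightarrow>
      \<bar>norm (rational_point F s v m) - norm (rational_point F s w n)\<bar> \<le> 6 * (1/2) ^ k"
    using * unfolding small_code_iff rational_of_code_rational_sub by linarith
  show "\<bar>norm (rational_point F s v m) - norm (rational_point F s w n)\<bar> \<le> 2 * (1/2) ^ k \<Longrightarrow>
      small_code (rational_sub (\<mu> m k) (\<nu> n k)) k"
    using * unfolding small_code_iff rational_of_code_rational_sub by linarith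
qed

lemma eq_zero_if_le_half_power:
  fixes a :: real
  assumes "\<And>k. a \<le> C * (1/2) ^ k" "0 \<le> a"
  shows "a = 0"
proof -
  have "(\<lambda>k. C * (1/2) ^ k) \<longlonglongrightarrow> C * 0"
    by (intro tendsto_mult tendsto_const LIMSEQ_power_zero) simp
  then have "a \<le> 0" using assms(1) by (intro LIMSEQ_le_const[of _ 0 a]) auto
  then show ?thesis using assms(2) by simp
qed

text \<open>Otherwise the ball on the left contains \<open>x + u\<close> and \<open>x - u\<close>,
  at distance \<open>2 * e\<close>, while two points of \<open>ball y e\<close> are closer than
  that. Inclusion in a small ball thus shows in the radius code, where it can be tested.\<close>

lemma radius_le_if_ball_subset:
  fixes x y z :: "'a::real_normed_vector"
  assumes sub: "ball x r \<subseteq> ball y e" and "0 \<le> e" "z \<noteq> 0"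
  shows "r \<le> e"
proof (rule ccontr)
  assume "\<not> r \<le> e"
  define u where "u = (e / norm z) *\<^sub>R z"
  have u: "norm u = e" using assms(2,3) by (simp add: u_def)
  have "x + u \<in> ball x r" "x - u \<in> ball x r"
    using u \<open>\<not> r \<le> e\<close> by (simp_all add: dist_norm)
  then have "dist y (x + u) < e" "dist y (x - u) < e"
    using subsetD[OF sub] unfolding mem_ball by blast+
  then have "dist (x + u) (x - u) < 2 * e"
    using dist_triangle3[of "x + u" "x - u" y] by simp
  moreover have "dist (x + u) (x - u) = norm (2 *\<^sub>R u)" by (simp add: dist_norm scaleR_2)
  ultimately show False using u assms(2) by simp
qed

lemma rational_ball_eq:
  "rational_ball F s v n = ball (rational_point F s v (pfst n)) (positive_rational_of_code (psnd n))"
  by (simp add: rational_ball_def split: prod.split)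

section \<open>From computable isometries to paths and back\<close>

context
  fixes F :: "complex set" and s :: "complex \<Rightarrow> 'a::banach \<Rightarrow> 'a" and v w :: "nat \<Rightarrow> 'a"
    and \<mu> \<nu> :: "nat \<Rightarrow> nat \<Rightarrow> nat"
  assumes banach: "banach_space_over F s"
    and v: "is_presentation F s v" and w: "is_presentation F s w"
    and \<mu>: "approximates_norms F s v \<mu>" and \<nu>: "approximates_norms F s w \<nu>"
    and \<mu>_rec: "recursive_in {} (\<lambda>z. \<mu> (pfst z) (psnd z))"
    and \<nu>_rec: "recursive_in {} (\<lambda>z. \<nu> (pfst z) (psnd z))"
begin

lemma recursive_in_norms:
  assumes "recursive_in A f" "recursive_in A g"
  shows "recursive_in A (\<lambda>x. \<mu> (f x) (g x))" "recursive_in A (\<lambda>x. \<nu> (f x) (g x))"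
  by (rule recursive_in_comp2[OF recursive_in_mono[OF \<mu>_rec] assms],
      rule recursive_in_comp2[OF recursive_in_mono[OF \<nu>_rec] assms])

text \<open>Lying in a rational ball is semidecidable: a precision \<open>l\<close> at which the
  approximate norm leaves room certifies it, and by the next lemma every true instance has such a
  certificate.\<close>

lemma below_radius_imp_dist_less:
  assumes "below_radius (\<nu> (point_sub F m n) l) l r"
  shows "dist (rational_point F s w m) (rational_point F s w n) < positive_rational_of_code r"
proof -
  have "\<bar>rational_of_code (\<nu> (point_sub F m n) l) -
      norm (rational_point F s w (point_sub F m n))\<bar> < (1/2) ^ l"
    using \<nu> by (simp add: approximates_norms_def)
  then show ?thesis
    using assms unfolding below_radius_iff rational_point_point_sub[OF banach] dist_norm by linarith
qed

lemma dist_less_imp_below_radius: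
  assumes "dist (rational_point F s w m) (rational_point F s w n) < positive_rational_of_code r"
  shows "\<exists>l. below_radius (\<nu> (point_sub F m n) l) l r"
proof -
  define e where "e = positive_rational_of_code r - dist (rational_point F s w m) (rational_point F s w n)"
  have "e > 0" using assms by (simp add: e_def)
  \<comment> \<open>Half of the gap, as two errors of \<open>(1/2) ^ l\<close> enter: that of the
    approximation and the one added in \<open>below_radius\<close>.\<close>
  then obtain l where l: "(1/2) ^ l < e / 2"
    using real_arch_pow_inv[of "e / 2" "1/2"] by auto
  have "\<bar>rational_of_code (\<nu> (point_sub F m n) l) -
      norm (rational_point F s w (point_sub F m n))\<bar> < (1/2) ^ l"
    using \<nu> by (simp add: approximates_norms_def)
  then have "below_radius (\<nu> (point_sub F m n) l) l r"
    using l unfolding below_radius_iff rational_point_point_sub[OF banach] e_def dist_norm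
    by argo
  then show ?thesis by blast
qed

text \<open>The search for a small ball around the image dovetails the computations on all balls around
  the given point.  In the trivial space, small balls need not have a small radius.\<close>

lemma computable_map_imp_approximation:
  assumes "computable_map_in A F s w s v \<Phi>"
  shows "\<exists>f. recursive_in A (\<lambda>z. f (pfst z) (psnd z)) \<and>
    (\<forall>m k. dist (rational_point F s v (f m k)) (\<Phi> (rational_point F s w m)) < (1/2) ^ k)"
proof (cases "\<exists>x::'a. x \<noteq> 0")
  case False
  then have trivial: "x = 0" for x :: 'a by blast
  have "dist x y < (1/2) ^ k" for x y :: 'a and k
    using trivial[of x] trivial[of y] by simp
  then show ?thesis by (intro exI[of _ "\<lambda>_ _. 0"] conjI rec_intros) blast
next
  case True
  then obtain x0 :: 'a where "x0 \<noteq> 0" by blast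
  obtain P where P: "partial_recursive_in A P"
    and sound: "\<And>m n. P m = Some n \<Longrightarrow> \<Phi> ` rational_ball F s w m \<subseteq> rational_ball F s v n"
    and complete: "\<And>p U. \<Phi> p \<in> interior U \<Longrightarrow>
      \<exists>m n. p \<in> rational_ball F s w m \<and> P m = Some n \<and> rational_ball F s v n \<subseteq> U"
    using assms unfolding computable_map_in_def by blast
  obtain H where H: "stage_approx A P H" using stage_approx_exists[OF P] by blast
  \<comment> \<open>A candidate \<open>y\<close> packs a stage, a ball of the domain and a
    precision. Required are that the algorithm has halted on the ball, that the point
    \<open>pfst x\<close> is certified to lie in it, and that the output has radius at most
    \<open>(1/2) ^ psnd x\<close>. The \<open>- 1\<close> undoes the \<open>Suc\<close> of the stage
    value.\<close>
  define cond where "cond x y \<longleftrightarrow> H (pfst (psnd y)) (pfst y) \<noteq> 0 \<and>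
      below_radius (\<nu> (point_sub F (pfst x) (pfst (pfst (psnd y)))) (psnd (psnd y))) (psnd (psnd y))
        (psnd (pfst (psnd y))) \<and>
      small_radius (psnd (H (pfst (psnd y)) (pfst y) - 1)) (psnd x)" for x y
  define Z where "Z x = (LEAST y. cond x y)" for x
  define f where "f m k = (let y = Z (prod_encode (m, k)) in pfst (H (pfst (psnd y)) (pfst y) - 1))" for m k
  have ex: "\<exists>y. cond x y" for x
  proof -
    let ?p = "rational_point F s w (pfst x)" and ?U = "ball (\<Phi> (rational_point F s w (pfst x))) ((1/2) ^ psnd x)"
    have "\<Phi> ?p \<in> interior ?U" by (simp add: interior_open)
    then obtain m n where m: "?p \<in> rational_ball F s w m" "P m = Some n" "rational_ball F s v n \<subseteq> ?U"
      using complete by blast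
    obtain t where t: "H m t = Suc n" using stage_approx_complete[OF H m(2)] by blast
    have "dist (rational_point F s w (pfst x)) (rational_point F s w (pfst m))
        < positive_rational_of_code (psnd m)"
      using m(1) by (simp add: rational_ball_eq dist_commute)
    then obtain l where "below_radius (\<nu> (point_sub F (pfst x) (pfst m)) l) l (psnd m)"
      using dist_less_imp_below_radius by blast
    moreover have "small_radius (psnd n) (psnd x)"
      unfolding small_radius_iff using m(3) unfolding rational_ball_eq
      by (rule radius_le_if_ball_subset) (use \<open>x0 \<noteq> 0\<close> in auto)
    ultimately have "cond x (prod_encode (t, prod_encode (m, l)))"
      using t by (simp add: cond_def)
    then show ?thesis by blast
  qed
  have "recursive_in A (\<lambda>x. of_bool (cond (pfst x) (psnd x)))"
    unfolding cond_def
    by (intro rec_intros recursive_in_norms stage_approx_recursive[OF H])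
  from this ex have Z_rec: "recursive_in A Z"
    unfolding Z_def by (rule recursive_in_Least)
  have "recursive_in A (\<lambda>z. f (pfst z) (psnd z))"
    unfolding f_def Let_def
    by (intro rec_intros recursive_in_comp[OF Z_rec] stage_approx_recursive[OF H])
  moreover have "dist (rational_point F s v (f m k)) (\<Phi> (rational_point F s w m)) < (1/2) ^ k" for m k
  proof -
    define y where "y = Z (prod_encode (m, k))"
    have c: "cond (prod_encode (m, k)) y"
      unfolding y_def Z_def using ex by (rule LeastI_ex)
    then obtain n where n: "H (pfst (psnd y)) (pfst y) = Suc n"
      unfolding cond_def using not0_implies_Suc by blast
    have "rational_point F s w m \<in> rational_ball F s w (pfst (psnd y))"
      using below_radius_imp_dist_less[of m "pfst (pfst (psnd y))" "psnd (psnd y)"] c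
      by (simp add: cond_def rational_ball_eq dist_commute)
    then have "\<Phi> (rational_point F s w m) \<in> rational_ball F s v n"
      using sound[OF stage_approx_sound[OF H n]] by blast
    moreover have "positive_rational_of_code (psnd n) \<le> (1/2) ^ k"
      using c n by (simp add: cond_def small_radius_iff)
    moreover have "f m k = pfst n" using n by (simp add: f_def y_def[symmetric] Let_def)
    ultimately show ?thesis by (simp add: rational_ball_eq)
  qed
  ultimately show ?thesis by blast
qed

text \<open>Approximate values come from the computability of \<open>\<Phi>\<close>. A preimage is
  found by trying rational points until the value of one passes the test; this ends because
  \<open>\<Phi>\<close> is onto and the rational points of the domain are dense.\<close>

lemma isomorphism_imp_path:
  assumes iso: "isometric_isomorphism F s s \<Phi>" and "computable_map_in A F s w s v \<Phi>"
  shows "\<exists>g. recursive_in A g \<and> (\<forall>m n k j. isometry_test F \<mu> \<nu> g m n k j)"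
proof -
  let ?p = "rational_point F s w" and ?q = "rational_point F s v"
  obtain f where f_rec: "recursive_in A (\<lambda>z. f (pfst z) (psnd z))"
    and f: "\<And>m k. dist (?q (f m k)) (\<Phi> (?p m)) < (1/2) ^ k"
    using computable_map_imp_approximation[OF assms(2)] by blast
  have bij: "bij \<Phi>" and add: "\<And>x y. \<Phi> (x + y) = \<Phi> x + \<Phi> y"
    and scale: "\<And>c x. c \<in> F \<Longrightarrow> \<Phi> (s c x) = s c (\<Phi> x)" and dist: "\<And>x y. dist (\<Phi> x) (\<Phi> y) = dist x y"
    using iso unfolding isometric_isomorphism_def by auto
  interpret \<Phi>: additive \<Phi> by standard (rule add)
  have norm: "norm (\<Phi> x) = norm x" for x
    using dist[of x 0] by (simp add: \<Phi>.zero)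
  have ex: "\<exists>i. small_code (\<mu> (point_sub F m (f i k)) k) k" for m k
  proof -
    obtain x where x: "\<Phi> x = ?q m" using bij by (metis bij_pointE)
    obtain i where "dist (?p i) x < (1/2) ^ k"
      using rational_point_near[OF banach w, of "(1/2) ^ k" x] by auto
    then have "dist (\<Phi> (?p i)) (?q m) < (1/2) ^ k" by (simp flip: x add: dist)
    then have "dist (?q m) (?q (f i k)) \<le> 3 * (1/2) ^ k"
      using f[of i k] dist_triangle3[of "?q m" "?q (f i k)" "\<Phi> (?p i)"]
        dist_commute[of "?q (f i k)" "\<Phi> (?p i)"] zero_le_dist[of "?q m" "?q (f i k)"]
      by linarith
    then have "small_code (\<mu> (point_sub F m (f i k)) k) k"
      by (intro approximates_normsD(2)[OF \<mu>])
        (simp add: rational_point_point_sub[OF banach] dist_norm)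
    then show ?thesis by blast
  qed
  \<comment> \<open>The search condition is the last conjunct of \<open>isometry_test\<close>, which
    therefore holds without an estimate of its own.\<close>
  define b where "b x = (LEAST i. small_code (\<mu> (point_sub F (pfst x) (f i (psnd x))) (psnd x)) (psnd x))" for x
  have "recursive_in A b"
    unfolding b_def
    by (rule recursive_in_Least) (intro rec_intros recursive_in_norms recursive_in_comp2[OF f_rec], rule ex)
  define g where "g x = prod_encode (f (pfst x) (psnd x), b x)" for x
  have g: "pfst (g (prod_encode (m, k))) = f m k" "psnd (g (prod_encode (m, k))) = b (prod_encode (m, k))" for m k
    by (simp_all add: g_def)
  have "recursive_in A g"
    unfolding g_def by (intro rec_intros f_rec \<open>recursive_in A b\<close>)
  moreover have "isometry_test F \<mu> \<nu> g m n k j" for m n k j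
    unfolding isometry_test_def g
  proof (intro conjI)
    let ?e = "(1/2) ^ k :: real"
    have e: "0 < ?e" by simp
    have fk: "norm (?q (f i k) - \<Phi> (?p i)) < ?e" for i
      using f[of i k] by (simp add: dist_norm)
    have "\<bar>norm (?q (f m k)) - norm (?p m)\<bar> \<le> norm (?q (f m k) - \<Phi> (?p m))"
      using norm_triangle_ineq3[of "?q (f m k)" "\<Phi> (?p m)"] by (simp add: norm)
    then show "small_code (rational_sub (\<mu> (f m k) k) (\<nu> m k)) k"
      using fk[of m] by (intro approximates_norms_small_diff(2)[OF \<mu> \<nu>]) linarith
    have "dist (?q (f m (k + j))) (\<Phi> (?p m)) < ?e"
      by (rule less_le_trans[OF f]) (simp add: power_decreasing)
    then have "dist (?q (f m k)) (?q (f m (k + j))) \<le> 3 * ?e"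
      using f[of m k] dist_triangle2[of "?q (f m k)" "?q (f m (k + j))" "\<Phi> (?p m)"] e by linarith
    then show "small_code (\<mu> (point_sub F (f m k) (f m (k + j))) k) k"
      by (intro approximates_normsD(2)[OF \<mu>])
        (simp add: rational_point_point_sub[OF banach] dist_norm)
    \<comment> \<open>Three errors below \<open>?e\<close> add up here, more than in any other
      conjunct; this is the origin of the bound 3.\<close>
    have eq: "?q (f (point_sub F m n) k) - (?q (f m k) - ?q (f n k)) =
        (?q (f (point_sub F m n) k) - \<Phi> (?p (point_sub F m n)))
        - ((?q (f m k) - \<Phi> (?p m)) - (?q (f n k) - \<Phi> (?p n)))"
      by (simp add: rational_point_point_sub[OF banach] \<Phi>.diff)
    have "norm (?q (f (point_sub F m n) k) - (?q (f m k) - ?q (f n k))) \<le> 3 * ?e"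
      using fk[of "point_sub F m n"] fk[of m] fk[of n]
        norm_triangle_ineq4[of "?q (f (point_sub F m n) k) - \<Phi> (?p (point_sub F m n))"
          "(?q (f m k) - \<Phi> (?p m)) - (?q (f n k) - \<Phi> (?p n))"]
        norm_triangle_ineq4[of "?q (f m k) - \<Phi> (?p m)" "?q (f n k) - \<Phi> (?p n)"]
      unfolding eq by linarith
    then show "small_code (\<mu> (point_sub F (f (point_sub F m n) k) (point_sub F (f m k) (f n k))) k) k"
      by (intro approximates_normsD(2)[OF \<mu>]) (simp add: rational_point_point_sub[OF banach])
    \<comment> \<open>Multiplication by \<open>unit_of F\<close>, a number of modulus 1, does not
      enlarge errors.\<close>
    have "dist (s (unit_of F) (?q (f m k))) (\<Phi> (?p (point_rotate F m))) = dist (?q (f m k)) (\<Phi> (?p m))"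
      by (simp add: rational_point_point_rotate[OF banach] scale unit_of_mem[OF banach]
          dist_scale[OF banach]) (simp add: unit_of_def)
    then have "dist (?q (f (point_rotate F m) k)) (s (unit_of F) (?q (f m k))) \<le> 3 * ?e"
      using f[of "point_rotate F m" k] f[of m k]
        dist_triangle2[of "?q (f (point_rotate F m) k)" "s (unit_of F) (?q (f m k))" "\<Phi> (?p (point_rotate F m))"] e
      by linarith
    then show "small_code (\<mu> (point_sub F (f (point_rotate F m) k) (point_rotate F (f m k))) k) k"
      by (intro approximates_normsD(2)[OF \<mu>])
        (simp add: rational_point_point_sub[OF banach] rational_point_point_rotate[OF banach] dist_norm)
    show "small_code (\<mu> (point_sub F m (f (b (prod_encode (m, k))) k)) k) k"
      unfolding b_def prod_encode_inverse fst_conv snd_conv using ex by (rule LeastI_ex)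
  qed
  ultimately show ?thesis by blast
qed

text \<open>The second conjunct makes the approximate values converge. In the limit the tests of
  norms, differences and rotations become exact identities, and the stored preimages make the limits
  dense. The isometry is computable because the convergence has the known rate
  \<open>5 * (1/2) ^ k\<close>.\<close>

lemma path_imp_isomorphism:
  assumes g_rec: "recursive_in A g" and test: "\<And>m n k j. isometry_test F \<mu> \<nu> g m n k j"
  shows "isometrically_isomorphic_in A F s w s v"
proof -
  let ?p = "rational_point F s w"
  define f where "f m k = pfst (g (prod_encode (m, k)))" for m k
  define q where "q m k = rational_point F s v (f m k)" for m k
  define b where "b m k = psnd (g (prod_encode (m, k)))" for m k
  have q_norm: "\<bar>norm (q m k) - norm (?p m)\<bar> \<le> 6 * (1/2) ^ k" for m k
    unfolding q_def
    by (rule approximates_norms_small_diff(1)[OF \<mu> \<nu>])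
      (use test[of m 0 k 0] in \<open>simp add: isometry_test_def f_def\<close>)
  have small: "norm (rational_point F s v m) \<le> 5 * (1/2) ^ k" if "small_code (\<mu> m k) k" for m k
    using approximates_normsD(1)[OF \<mu> that] .
  have q_cauchy: "norm (q m k - q m (k + j)) \<le> 5 * (1/2) ^ k" for m k j
    using test[of m 0 k j] small[of "point_sub F (f m k) (f m (k + j))" k]
    by (simp add: isometry_test_def q_def f_def rational_point_point_sub[OF banach])
  have q_sub: "norm (q (point_sub F m n) k - (q m k - q n k)) \<le> 5 * (1/2) ^ k" for m n k
    using test[of m n k 0] small[of "point_sub F (f (point_sub F m n) k) (point_sub F (f m k) (f n k))" k]
    by (simp add: isometry_test_def q_def f_def rational_point_point_sub[OF banach])
  have q_rotate: "norm (q (point_rotate F m) k - s (unit_of F) (q m k)) \<le> 5 * (1/2) ^ k" for m k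
    using test[of m 0 k 0] small[of "point_sub F (f (point_rotate F m) k) (point_rotate F (f m k))" k]
    by (simp add: isometry_test_def q_def f_def rational_point_point_sub[OF banach]
        rational_point_point_rotate[OF banach])
  have q_dense: "norm (rational_point F s v m - q (b m k) k) \<le> 5 * (1/2) ^ k" for m k
    using test[of m 0 k 0] small[of "point_sub F m (f (b m k) k)" k]
    by (simp add: isometry_test_def q_def f_def b_def rational_point_point_sub[OF banach])
  have half: "\<exists>k. C * (1/2) ^ k < e" if "e > 0" "C > 0" for e C :: real
  proof -
    have "0 < e / C" using that by simp
    then obtain k where "(1/2) ^ k < e / C"
      using real_arch_pow_inv[of "e / C" "1/2"] by auto
    then show ?thesis using that by (intro exI[of _ k]) (simp add: field_simps)
  qed
  have "\<exists>l. (\<lambda>k. q m k) \<longlonglongrightarrow> l" for m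
  proof -
    have "Cauchy (q m)"
    proof (rule CauchyI')
      fix e :: real assume "e > 0"
      then obtain k where k: "10 * (1/2) ^ k < e" using half[of e 10] by auto
      have "dist (q m i) (q m j) < e" if "k \<le> i" "i < j" for i j
        using q_cauchy[of m k "i - k"] q_cauchy[of m k "j - k"] that k
          dist_triangle3[of "q m i" "q m j" "q m k"] by (simp add: dist_norm)
      then show "\<exists>M. \<forall>i\<ge>M. \<forall>j>i. dist (q m i) (q m j) < e" by blast
    qed
    then show ?thesis using Cauchy_convergent convergent_def by blast
  qed
  then obtain \<phi> where lim: "\<And>m. (\<lambda>k. q m k) \<longlonglongrightarrow> \<phi> m" by metis
  have q\<phi>: "norm (q m k - \<phi> m) \<le> 5 * (1/2) ^ k" for m k
  proof -
    have "(\<lambda>j. q m (j + k)) \<longlonglongrightarrow> \<phi> m" by (rule LIMSEQ_ignore_initial_segment[OF lim])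
    then have "(\<lambda>j. norm (q m k - q m (j + k))) \<longlonglongrightarrow> norm (q m k - \<phi> m)"
      by (intro tendsto_intros)
    moreover have "norm (q m k - q m (j + k)) \<le> 5 * (1/2) ^ k" for j
      using q_cauchy[of m k j] by (simp add: add.commute)
    ultimately show ?thesis by (intro LIMSEQ_le_const2) auto
  qed
  have \<phi>_norm: "norm (\<phi> m) = norm (?p m)" for m
  proof -
    \<comment> \<open>11 = 6 + 5, from the comparison of norms and the distance to the limit.
      Likewise, below, 20 = 5 + 3 * 5 for differences and 15 = 3 * 5 for rotations.\<close>
    have "\<bar>norm (\<phi> m) - norm (?p m)\<bar> \<le> 11 * (1/2) ^ k" for k
      using q_norm[of m k] q\<phi>[of m k] norm_triangle_ineq3[of "q m k" "\<phi> m"] by linarith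
    then have "\<bar>norm (\<phi> m) - norm (?p m)\<bar> = 0" by (rule eq_zero_if_le_half_power) simp
    then show ?thesis by simp
  qed
  have \<phi>_sub: "\<phi> (point_sub F m n) = \<phi> m - \<phi> n" for m n
  proof -
    have "norm (\<phi> (point_sub F m n) - (\<phi> m - \<phi> n)) \<le> 20 * (1/2) ^ k" for k
    proof -
      have eq: "\<phi> (point_sub F m n) - (\<phi> m - \<phi> n) = (q (point_sub F m n) k - (q m k - q n k)) -
          ((q (point_sub F m n) k - \<phi> (point_sub F m n)) - ((q m k - \<phi> m) - (q n k - \<phi> n)))"
        by simp
      show ?thesis
        using q_sub[of m n k] q\<phi>[of "point_sub F m n" k] q\<phi>[of m k] q\<phi>[of n k]
          norm_triangle_ineq4[of "q (point_sub F m n) k - (q m k - q n k)"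
            "(q (point_sub F m n) k - \<phi> (point_sub F m n)) - ((q m k - \<phi> m) - (q n k - \<phi> n))"]
          norm_triangle_ineq4[of "q (point_sub F m n) k - \<phi> (point_sub F m n)"
            "(q m k - \<phi> m) - (q n k - \<phi> n)"]
          norm_triangle_ineq4[of "q m k - \<phi> m" "q n k - \<phi> n"]
        unfolding eq by linarith
    qed
    then have "norm (\<phi> (point_sub F m n) - (\<phi> m - \<phi> n)) = 0"
      by (rule eq_zero_if_le_half_power) simp
    then show ?thesis by simp
  qed
  have \<phi>_rotate: "\<phi> (point_rotate F m) = s (unit_of F) (\<phi> m)" for m
  proof -
    have "dist (\<phi> (point_rotate F m)) (s (unit_of F) (\<phi> m)) \<le> 15 * (1/2) ^ k" for k
    proof -
      have "dist (s (unit_of F) (q m k)) (s (unit_of F) (\<phi> m)) = dist (q m k) (\<phi> m)"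
        by (simp add: unit_of_mem[OF banach] dist_scale[OF banach]) (simp add: unit_of_def)
      then show ?thesis
        using q_rotate[of m k] q\<phi>[of m k] q\<phi>[of "point_rotate F m" k]
          dist_triangle3[of "\<phi> (point_rotate F m)" "s (unit_of F) (q m k)" "q (point_rotate F m) k"]
          dist_triangle[of "\<phi> (point_rotate F m)" "s (unit_of F) (\<phi> m)" "s (unit_of F) (q m k)"]
        by (simp add: dist_norm)
    qed
    then have "dist (\<phi> (point_rotate F m)) (s (unit_of F) (\<phi> m)) = 0"
      by (rule eq_zero_if_le_half_power) simp
    then show ?thesis by simp
  qed
  have "closure (range \<phi>) = UNIV"
  proof -
    have "x \<in> closure (range \<phi>)" for x
      unfolding closure_approachable
    proof (intro allI impI)
      fix e :: real assume "e > 0"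
      then obtain m where m: "dist (rational_point F s v m) x < e / 2"
        using rational_point_near[OF banach v, of "e / 2" x] by auto
      \<comment> \<open>The preimage test and the limit contribute \<open>5 * (1/2) ^ k\<close>
        each, and their sum has to stay below \<open>e / 2\<close>.\<close>
      obtain k where k: "20 * (1/2) ^ k < e" using half[of e 20] \<open>e > 0\<close> by auto
      have "dist (rational_point F s v m) (\<phi> (b m k)) \<le> 10 * (1/2) ^ k"
        using q_dense[of m k] q\<phi>[of "b m k" k]
          dist_triangle[of "rational_point F s v m" "\<phi> (b m k)" "q (b m k) k"] by (simp add: dist_norm)
      then have "dist (\<phi> (b m k)) x < e"
        using m k dist_triangle3[of "\<phi> (b m k)" x "rational_point F s v m"] by simp
      then show "\<exists>y\<in>range \<phi>. dist y x < e" by blast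
    qed
    then show ?thesis by blast
  qed
  then obtain \<Psi> where iso: "isometric_isomorphism F s s \<Psi>" and \<Psi>: "\<And>m. \<Psi> (?p m) = \<phi> m"
    using isometric_extension[OF banach closure_range_rational_point[OF banach w] _
        rational_point_point_sub[OF banach] \<phi>_sub rational_point_point_rotate[OF banach] \<phi>_rotate \<phi>_norm]
    by blast
  have dist: "dist (\<Psi> x) (\<Psi> y) = dist x y" for x y
    using iso by (simp add: isometric_isomorphism_def)
  \<comment> \<open>The output ball has twice the radius: one radius for the image of the ball and
    one for the error of the center. A numerator \<open>a + 1\<close> is coded by \<open>a\<close>,
    so \<open>Suc (2 * a)\<close> doubles it. With denominator \<open>d + 1\<close> the radius is at
    least \<open>(1/2) ^ d\<close>, and precision \<open>d + 3\<close> leaves an error of at most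
    5/8 of that.\<close>
  define h where "h z = prod_encode (f (pfst z) (psnd (psnd z) + 3),
      prod_encode (Suc (2 * pfst (psnd z)), psnd (psnd z)))" for z
  have h_rec: "recursive_in A h"
    unfolding h_def f_def by (intro rec_intros recursive_in_comp[OF g_rec])
  define r where "r z = positive_rational_of_code (psnd z)" for z
  have h_radius: "positive_rational_of_code (psnd (h z)) = 2 * r z" for z
    by (simp add: h_def r_def positive_rational_of_code_eq)
  have h_center: "dist (rational_point F s v (pfst (h z))) (\<Psi> (?p (pfst z))) \<le> r z" for z
  proof -
    define d where "d = psnd (psnd z)"
    have "real (Suc d) \<le> 2 ^ d"
      using of_nat_mono[OF Suc_leI[OF less_exp[of d]]] by (metis of_nat_numeral of_nat_power)
    then have "(1/2) ^ d \<le> 1 / real (Suc d)"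
      by (simp add: power_one_over field_simps)
    also have "\<dots> \<le> r z"
      unfolding r_def positive_rational_of_code_eq d_def by (intro divide_right_mono) simp_all
    finally have "(1/2) ^ d \<le> r z" .
    moreover have "5 * (1/2) ^ (d + 3) \<le> ((1/2) ^ d :: real)"
      by (simp add: power_add eval_nat_numeral)
    ultimately have "norm (q (pfst z) (d + 3) - \<phi> (pfst z)) \<le> r z"
      using q\<phi>[of "pfst z" "d + 3"] by linarith
    then show ?thesis
      by (simp add: h_def q_def dist_norm \<Psi> d_def)
  qed
  have image: "\<Psi> ` rational_ball F s w z \<subseteq> rational_ball F s v (h z)" for z
  proof (rule image_subsetI)
    fix x assume "x \<in> rational_ball F s w z"
    then have "dist (\<Psi> (?p (pfst z))) (\<Psi> x) < r z"
      by (simp add: rational_ball_eq r_def dist)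
    then show "\<Psi> x \<in> rational_ball F s v (h z)"
      using h_center[of z] dist_triangle[of "rational_point F s v (pfst (h z))" "\<Psi> x" "\<Psi> (?p (pfst z))"]
      by (simp add: rational_ball_eq h_radius)
  qed
  have small_image: "\<exists>z. p \<in> rational_ball F s w z \<and> rational_ball F s v (h z) \<subseteq> U"
    if "\<Psi> p \<in> interior U" for p U
  proof -
    obtain e where e: "e > 0" "ball (\<Psi> p) e \<subseteq> U"
      using \<open>\<Psi> p \<in> interior U\<close> mem_interior by blast
    \<comment> \<open>Points of the output ball are within \<open>4 * r z\<close> of
      \<open>\<Psi> p\<close>: one radius from \<open>p\<close> to the center, one for the error of
      the output center, two for the output radius.\<close>
    obtain k where "inverse (real (Suc k)) < e / 4" using reals_Archimedean[of "e / 4"] e(1) by auto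
    obtain c where c: "dist (?p c) p < inverse (real (Suc k))"
      using rational_point_near[OF banach w, of "inverse (real (Suc k))" p] by auto
    define z where "z = prod_encode (c, prod_encode (0, k))"
    have rz: "r z = inverse (real (Suc k))"
      by (simp add: z_def r_def positive_rational_of_code_eq inverse_eq_divide)
    have "rational_ball F s v (h z) \<subseteq> ball (\<Psi> p) e"
    proof
      fix y assume "y \<in> rational_ball F s v (h z)"
      then have "dist (rational_point F s v (pfst (h z))) y < 2 * r z"
        by (simp add: rational_ball_eq h_radius)
      moreover have "dist (\<Psi> p) (\<Psi> (?p (pfst z))) < r z"
        using c by (simp add: z_def rz[unfolded z_def] dist dist_commute)
      ultimately have "dist (\<Psi> p) y < 4 * r z"
        using h_center[of z] dist_triangle[of "\<Psi> p" y "\<Psi> (?p (pfst z))"]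
          dist_triangle3[of "\<Psi> (?p (pfst z))" y "rational_point F s v (pfst (h z))"] by linarith
      then show "y \<in> ball (\<Psi> p) e" using rz \<open>inverse (real (Suc k)) < e / 4\<close> by simp
    qed
    moreover have "p \<in> rational_ball F s w z"
      using c rz by (simp add: rational_ball_eq r_def z_def)
    ultimately show ?thesis using e(2) by blast
  qed
  have "computable_map_in A F s w s v \<Psi>"
    unfolding computable_map_in_def
  proof (intro exI[of _ "\<lambda>z. Some (h z)"] conjI allI impI)
    show "\<exists>z n. p \<in> rational_ball F s w z \<and> Some (h z) = Some n \<and> rational_ball F s v n \<subseteq> U"
      if "\<Psi> p \<in> interior U" for p U
      using small_image[OF that] by blast
  qed (use h_rec image in \<open>auto simp: recursive_in_def\<close>)
  then show ?thesis using iso unfolding isometrically_isomorphic_in_def by blast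
qed

end

theorem theorem5p1:
  fixes d :: "nat set set"
  assumes "d \<in> turing_degrees" and "d \<noteq> zero_degree"
    and "low_for_isomorphism d"
  shows "low_for_isometric_isomorphism TYPE('a::banach) d"
  unfolding low_for_isometric_isomorphism_def
proof (intro allI impI, elim conjE bexE)
  fix F and s :: "complex \<Rightarrow> 'a \<Rightarrow> 'a" and v w A
  assume banach: "banach_space_over F s"
    and v: "computable_presentation F s v" and w: "computable_presentation F s w"
    and "A \<in> d" and "isometrically_isomorphic_in A F s w s v"
  have pres: "is_presentation F s v" "is_presentation F s w"
    using v w by (simp_all add: computable_presentation_def)
  obtain \<mu> \<nu> where norms: "approximates_norms F s v \<mu>" "approximates_norms F s w \<nu>"
    and rec: "recursive_in {} (\<lambda>z. \<mu> (pfst z) (psnd z))" "recursive_in {} (\<lambda>z. \<nu> (pfst z) (psnd z))"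
    using computable_presentation_norms[OF v] computable_presentation_norms[OF w] by blast
  note facts = banach pres norms rec
  obtain \<Phi> where "isometric_isomorphism F s s \<Phi>" "computable_map_in A F s w s v \<Phi>"
    using \<open>isometrically_isomorphic_in A F s w s v\<close> unfolding isometrically_isomorphic_in_def by blast
  then obtain g where "recursive_in A g" "\<And>m n k j. isometry_test F \<mu> \<nu> g m n k j"
    using isomorphism_imp_path[OF facts] by blast
  then have "\<exists>g'. recursive_in {} g' \<and> (\<forall>l. isometry_node F \<mu> \<nu> l (history g' l))"
    using isometry_node_history[of F \<mu> \<nu> g]
    by (intro low_for_isomorphism_imp_low_for_paths[OF assms(3) \<open>A \<in> d\<close> recursive_in_isometry_node[OF rec]])
      auto
  \<comment> \<open>The computable path may differ from \<open>g\<close>, and the isometry that it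
    yields need not be \<open>\<Phi>\<close>.\<close>
  then obtain g' where "recursive_in {} g'" "\<And>m n k j. isometry_test F \<mu> \<nu> g' m n k j"
    unfolding isometry_node_history by blast
  then show "isometrically_isomorphic_in {} F s w s v"
    by (rule path_imp_isomorphism[OF facts])
qed

end
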